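(* Let $p$ be a prime and $G=\mathbb{Z}_{p^2}\times\mathbb{Z}_p$. A subset $A\subset G$ is a spectral set if and only if it is a tile of $G$ by translation.
   Context: $\mathbb{Z}_N=\mathbb{Z}/N\mathbb{Z}$. For $b=(b_1,b_2)\in G$ let $\chi_b$ be the character $\chi_b(a_1,a_2)=e^{2\pi i(a_1b_1/p^2+a_2b_2/p)}$; every character of $G$ is of this form. A nonempty set $A\subset G$ is a spectral set if there is $B\subset G$ such that $\{\chi_b|_A: b\in B\}$ is an orthogonal basis of $L^2(A)$ (functions on $A$ with counting measure); $B$ is then called a spectrum of $A$. A set $A\subset G$ is a tile if there is $T\subset G$ such that every element of $G$ can be written uniquely as $a+t$ with $a\in A$, $t\in T$ (i.e. $A\oplus T=G$). *)

theory Defs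
  imports Complex_Main "HOL-Computational_Algebra.Primes"
begin

text \<open>The group G = Z_{p^2} x Z_p, elements represented by canonical residues.\<close>
definition grp :: "nat \<Rightarrow> (nat \<times> nat) set" where
  "grp p = {0..<p^2} \<times> {0..<p}"

definition gadd :: "nat \<Rightarrow> nat \<times> nat \<Rightarrow> nat \<times> nat \<Rightarrow> nat \<times> nat" where
  "gadd p x y = ((fst x + fst y) mod p^2, (snd x + snd y) mod p)"

definition chr :: "nat \<Rightarrow> nat \<times> nat \<Rightarrow> nat \<times> nat \<Rightarrow> complex" where
  "chr p b a = exp (2 * complex_of_real pi * \<i> *
      complex_of_real (real (fst a * fst b) / real (p^2) + real (snd a * snd b) / real p))"

definition ip :: "(nat \<times> nat) set \<Rightarrow> (nat \<times> nat \<Rightarrow> complex) \<Rightarrow> (nat \<times> nat \<Rightarrow> complex) \<Rightarrow> complex" where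
  "ip A f g = (\<Sum>a\<in>A. f a * cnj (g a))"

definition spectrum_of :: "nat \<Rightarrow> (nat \<times> nat) set \<Rightarrow> (nat \<times> nat) set \<Rightarrow> bool" where
  "spectrum_of p A B \<longleftrightarrow> B \<subseteq> grp p \<and>
     (\<forall>b\<in>B. \<forall>b'\<in>B. b \<noteq> b' \<longrightarrow> ip A (chr p b) (chr p b') = 0) \<and>
     (\<forall>c :: nat \<times> nat \<Rightarrow> complex. (\<forall>a\<in>A. (\<Sum>b\<in>B. c b * chr p b a) = 0) \<longrightarrow> (\<forall>b\<in>B. c b = 0)) \<and>
     (\<forall>f :: nat \<times> nat \<Rightarrow> complex. \<exists>c :: nat \<times> nat \<Rightarrow> complex.
        \<forall>a\<in>A. f a = (\<Sum>b\<in>B. c b * chr p b a))"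

definition spectral_set :: "nat \<Rightarrow> (nat \<times> nat) set \<Rightarrow> bool" where
  "spectral_set p A \<longleftrightarrow> A \<noteq> {} \<and> A \<subseteq> grp p \<and> (\<exists>B. spectrum_of p A B)"

definition is_tile :: "nat \<Rightarrow> (nat \<times> nat) set \<Rightarrow> bool" where
  "is_tile p A \<longleftrightarrow> A \<subseteq> grp p \<and> (\<exists>T \<subseteq> grp p.
     \<forall>g\<in>grp p. \<exists>!x. fst x \<in> A \<and> snd x \<in> T \<and> g = gadd p (fst x) (snd x))"

end

theory Submission
  imports Defs "HOL-Computational_Algebra.Polynomial" "HOL-Number_Theory.Cong" "HOL-Library.Real_Mod"
begin

text \<open>
  A set of characters that is orthogonal on \<open>A\<close> has at most \<open>|A|\<close> elements, and if it has exactly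
  \<open>|A|\<close> elements then, dually, \<open>\<Sum>\<^sub>b \<chi>\<^sub>b(a - a') = 0\<close> for distinct \<open>a, a' \<in> A\<close>. By Eisenstein's
  criterion the zero set \<open>Z(A)\<close> of the Fourier transform of \<open>1\<^sub>A\<close> is closed under multiplication by
  units, so it is determined by the representatives \<open>(1, v)\<close>, \<open>(p, 0)\<close> and \<open>(p u, 1)\<close>. For each
  combination of representatives in \<open>Z(A)\<close> that can occur there is an explicit set of \<open>p\<close>, \<open>p\<^sup>2\<close> or
  \<open>p\<^sup>3\<close> characters whose differences lie in \<open>Z(A)\<close>.

  If \<open>A \<oplus> T = G\<close>, then \<open>Z(A) \<union> Z(T)\<close> contains every nonzero frequency, and the bound on orthogonal
  sets for \<open>T\<close> forces enough frequencies into \<open>Z(A)\<close> for one of the explicit sets to be a spectrum of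
  \<open>A\<close>. If \<open>B\<close> is a spectrum of \<open>A\<close>, then the pigeonhole principle applied to the differences of
  \<open>B\<close> forces enough frequencies into \<open>Z(A)\<close>; the bound on orthogonal sets then determines \<open>|A|\<close>,
  and the dual relations for the explicit set separate \<open>A\<close> from an explicit tiling complement.
\<close>

section \<open>Integer relations between powers of a root of unity\<close>

text \<open>Allowing a nonzero multiple of \<open>E\<close> replaces Gauss's lemma. As
  \<open>q\<close> is prime among the integer polynomials, each factor \<open>q\<close> of
  \<open>c\<close> can be cancelled from \<open>Q\<close> or \<open>H\<close>; once \<open>q\<close>
  does not divide \<open>c\<close>, the classical argument applies.\<close>

lemma eisenstein:
  fixes E Q H :: "int poly" and q c :: int
  assumes q: "prime q"
    and lead: "\<not> q dvd lead_coeff E"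
    and low: "\<And>i. i < degree E \<Longrightarrow> q dvd coeff E i"
    and zero: "\<not> q\<^sup>2 dvd coeff E 0"
    and "c \<noteq> 0" and "smult c E = Q * H"
  shows "degree Q = 0 \<or> degree H = 0"
  using assms(5,6)
proof (induction "nat \<bar>c\<bar>" arbitrary: c Q H rule: less_induct)
  case less
  have pq: "prime_elem [:q:]" using q by (simp only: prime_elem_const_poly_iff) (rule prime_imp_prime_elem)
  have q1: "q > 1" using q by (simp add: prime_gt_1_int)
  show ?case
  proof (cases "q dvd c")
    case True
    then obtain c' where c': "c = q * c'" by blast
    have c'0: "c' \<noteq> 0" "nat \<bar>c'\<bar> < nat \<bar>c\<bar>" using less.prems q1 c' by (auto simp: abs_mult)
    have eq: "[:q:] * smult c' E = Q * H" using less.prems(2) unfolding c' by (simp add: mult.commute)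
    then have "[:q:] dvd Q * H" by (metis dvd_triv_left)
    then consider "[:q:] dvd Q" | "[:q:] dvd H" using pq prime_elem_dvd_multD by blast
    then show ?thesis
    proof cases
      case 1
      then obtain Q' where Q': "Q = [:q:] * Q'" by blast
      have "[:q:] * smult c' E = [:q:] * (Q' * H)" using eq Q' by (simp add: mult.assoc)
      then have "smult c' E = Q' * H" using q1 by (subst (asm) mult_cancel_left) auto
      from less.hyps[OF c'0(2,1) this] show ?thesis using Q' q1 by auto
    next
      case 2
      then obtain H' where H': "H = [:q:] * H'" by blast
      have "[:q:] * smult c' E = [:q:] * (Q * H')" using eq H' by (simp add: mult.left_commute)
      then have "smult c' E = Q * H'" using q1 by (subst (asm) mult_cancel_left) auto
      from less.hyps[OF c'0(2,1) this] show ?thesis using H' q1 by auto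
    qed
  next
    case False
    have E0: "E \<noteq> 0" using zero by auto
    \<comment> \<open>The first coefficient of \<open>U\<close> not divisible by \<open>q\<close>
      produces such a coefficient of \<open>smult c E\<close> at the same index. That index is
      therefore at least \<open>degree E\<close>, which leaves degree 0 for
      \<open>V\<close>.\<close>
    have key: "degree V = 0" if eq: "smult c E = U * V" and V: "\<not> q dvd coeff V 0" for U V
    proof -
      have UV: "U \<noteq> 0" "V \<noteq> 0" using eq E0 less.prems(1) by auto
      have deg: "degree E = degree U + degree V"
        using arg_cong[OF eq, of degree] less.prems(1) UV by (simp add: degree_mult_eq)
      have "c * lead_coeff E = lead_coeff U * lead_coeff V"
        using arg_cong[OF eq, of lead_coeff] less.prems(1) by (simp add: lead_coeff_mult)
      then have "\<not> q dvd lead_coeff U"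
        using False lead q by (metis dvd_mult2 prime_dvd_mult_iff)
      then have ex: "\<exists>i. \<not> q dvd coeff U i" by blast
      define i where "i = (LEAST i. \<not> q dvd coeff U i)"
      have i: "\<not> q dvd coeff U i" and li: "\<And>j. j < i \<Longrightarrow> q dvd coeff U j"
        unfolding i_def using LeastI_ex[OF ex] not_less_Least by blast+
      have "c * coeff E i = (\<Sum>j\<le>i. coeff U j * coeff V (i - j))"
        using arg_cong[OF eq, of "\<lambda>f. coeff f i"] by (simp add: coeff_mult)
      also have "\<dots> = (\<Sum>j<i. coeff U j * coeff V (i - j)) + coeff U i * coeff V 0"
        by (simp add: lessThan_Suc_atMost[symmetric])
      finally have s: "c * coeff E i = \<dots>" .
      have "q dvd (\<Sum>j<i. coeff U j * coeff V (i - j))"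
        using li by (intro dvd_sum) auto
      moreover have "\<not> q dvd coeff U i * coeff V 0" using i V q by (simp add: prime_dvd_mult_iff)
      ultimately have "\<not> q dvd c * coeff E i" unfolding s by (simp add: dvd_add_right_iff)
      then have "\<not> i < degree E" using low by auto
      moreover have "i \<le> degree U" using i le_degree by (metis dvd_0_right)
      ultimately show ?thesis using deg by linarith
    qed
    have "\<not> q\<^sup>2 dvd coeff Q 0 * coeff H 0"
    proof
      assume *: "q\<^sup>2 dvd coeff Q 0 * coeff H 0"
      have "c * coeff E 0 = coeff Q 0 * coeff H 0"
        using arg_cong[OF less.prems(2), of "\<lambda>f. coeff f 0"] by (simp add: coeff_mult)
      moreover have "coprime (q\<^sup>2) c" using False q by (simp add: prime_imp_coprime)
      ultimately show False using * zero by (metis coprime_dvd_mult_right_iff)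
    qed
    then have "\<not> q dvd coeff Q 0 \<or> \<not> q dvd coeff H 0"
      by (auto simp: power2_eq_square mult_dvd_mono)
    then show ?thesis using key[of Q H] key[of H Q] less.prems(2) by (auto simp: mult.commute)
  qed
qed

section \<open>The cyclotomic polynomial of order \<open>p^2\<close>\<close>

abbreviation ipoly :: "int poly \<Rightarrow> complex \<Rightarrow> complex" where
  "ipoly f z \<equiv> poly (map_poly of_int f) z"

lemma map_poly_of_int_mult:
  "map_poly (of_int :: int \<Rightarrow> complex) (f * g) = map_poly of_int f * map_poly of_int g"
  by (rule poly_eqI) (simp add: coeff_map_poly coeff_mult)

lemma map_poly_of_int_add:
  "map_poly (of_int :: int \<Rightarrow> complex) (f + g) = map_poly of_int f + map_poly of_int g"
  by (rule poly_eqI) (simp add: coeff_map_poly)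

lemma map_poly_of_int_smult:
  "map_poly (of_int :: int \<Rightarrow> complex) (smult c f) = smult (of_int c) (map_poly of_int f)"
  by (rule poly_eqI) (simp add: coeff_map_poly)

lemma ipoly_monom_sum:
  "ipoly (\<Sum>a\<in>A. monom (c a) (n a)) z = (\<Sum>a\<in>A. of_int (c a) * z ^ n a)"
  by (induction A rule: infinite_finite_induct)
    (simp_all add: map_poly_of_int_add map_poly_monom poly_monom)

text \<open>All binomial coefficients in row \<open>p\<close> except the two outer ones are
  divisible by \<open>p\<close>.\<close>

lemma prime_dvd_add_power_diff:
  fixes a b :: "'a :: comm_ring_1"
  assumes "prime p"
  shows "of_nat p dvd (a + b) ^ p - a ^ p - b ^ p"
proof -
  have p0: "p > 0" using assms prime_gt_0_nat by blast
  have "(a + b) ^ p = (\<Sum>k\<le>p. of_nat (p choose k) * a ^ k * b ^ (p - k))"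
    by (rule binomial_ring)
  also have "{..p} = insert 0 (insert p {0<..<p})" by auto
  also have "(\<Sum>k\<in>\<dots>. of_nat (p choose k) * a ^ k * b ^ (p - k)) =
      b ^ p + (a ^ p + (\<Sum>k\<in>{0<..<p}. of_nat (p choose k) * a ^ k * b ^ (p - k)))"
    using p0 by simp
  finally have *: "(a + b) ^ p - a ^ p - b ^ p =
      (\<Sum>k\<in>{0<..<p}. of_nat (p choose k) * a ^ k * b ^ (p - k))" by simp
  have "of_nat p dvd (of_nat (p choose k) :: 'a)" if "k \<in> {0<..<p}" for k
    using dvd_choose_prime[of k p] that assms by (auto elim!: dvdE)
  then show ?thesis unfolding * by (intro dvd_sum) (simp add: dvd_mult2)
qed

text \<open>For prime \<open>p\<close> this is the cyclotomic polynomial of order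
  \<open>p^2\<close>.\<close>

definition cyclo :: "nat \<Rightarrow> int poly" where
  "cyclo p = (\<Sum>i<p. monom 1 (i * p))"

text \<open>With \<open>Y = X + 1\<close> the geometric sum gives
  \<open>E * (Y^p - 1) = (Y^p)^p - 1\<close>. Modulo \<open>p\<close>, the Frobenius map turns this
  into \<open>X^p * E = X^(p*p)\<close>, so \<open>E\<close> is congruent to
  \<open>X^(p*(p-1))\<close>, as Eisenstein's criterion requires.\<close>

lemma coeff_cyclo_shift:
  fixes p :: nat
  assumes "prime p"
  defines "E \<equiv> pcompose (cyclo p) [:1, 1:]"
  shows "int p dvd coeff E i - (if i = p * (p - 1) then 1 else 0)"
proof -
  define X Y P :: "int poly" where "X = [:0, 1:]" and "Y = [:1, 1:]" and "P = of_nat p"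
  have Y: "Y = X + 1" by (simp add: X_def Y_def one_pCons)
  have p1: "p > 1" using assms prime_gt_1_nat by blast
  have mon: "pcompose (monom 1 k) Y = Y ^ k" for k
    by (induction k) (simp_all add: monom_Suc pcompose_pCons monom_0 one_pCons[symmetric] pcompose_1)
  have E: "E = (\<Sum>i<p. (Y ^ p) ^ i)"
    unfolding E_def cyclo_def Y_def[symmetric]
    by (simp add: pcompose_sum mon power_mult[symmetric] mult.commute)
  have EY: "E * (Y ^ p - 1) = (Y ^ p) ^ p - 1"
    unfolding E by (subst power_diff_1_eq) (simp add: mult.commute)
  have X_pow: "X ^ k = monom 1 k" for k
    by (induction k) (simp_all add: X_def monom_Suc monom_0 one_pCons)
  have 1: "P dvd Y ^ p - X ^ p - 1"
    unfolding P_def Y using prime_dvd_add_power_diff[OF assms(1), of X 1] by simp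
  have "Y ^ p - (X ^ p + 1) dvd (Y ^ p) ^ p - (X ^ p + 1) ^ p"
    by (subst power_diff_sumr2) simp
  then have "P dvd (Y ^ p) ^ p - (X ^ p + 1) ^ p"
    using 1 by (metis diff_diff_eq dvd_trans)
  moreover have "P dvd (X ^ p + 1) ^ p - (X ^ p) ^ p - 1"
    unfolding P_def using prime_dvd_add_power_diff[OF assms(1), of "X ^ p" 1] by simp
  ultimately have 2: "P dvd (Y ^ p) ^ p - (X ^ p) ^ p - 1"
    by (metis (no_types, lifting) add_diff_eq diff_add_cancel dvd_add)
  have "X ^ p * E - (X ^ p) ^ p = ((Y ^ p) ^ p - (X ^ p) ^ p - 1) - E * (Y ^ p - X ^ p - 1)"
    using EY by (simp only: right_diff_distrib mult_1_right) (simp add: mult.commute)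
  also have "P dvd \<dots>" by (rule dvd_diff[OF 2 dvd_mult[OF 1]])
  finally have "[:int p:] dvd monom 1 p * E - monom 1 (p * p)"
    by (simp add: P_def of_nat_poly X_pow[symmetric] power_mult)
  then have "int p dvd coeff (monom 1 p * E - monom 1 (p * p)) (p + i)"
    unfolding const_poly_dvd_iff by blast
  moreover have "p * p = p + i \<longleftrightarrow> i = p * (p - 1)"
    using p1 by (auto simp: algebra_simps diff_mult_distrib2)
  ultimately show ?thesis by (simp add: coeff_monom_mult coeff_diff)
qed

lemma degree_cyclo: "p > 1 \<Longrightarrow> degree (cyclo p) = p * (p - 1)"
  and lead_coeff_cyclo: "p > 1 \<Longrightarrow> lead_coeff (cyclo p) = 1"
proof -
  assume p: "p > 1"
  have c: "coeff (cyclo p) k = (\<Sum>i<p. if i * p = k then 1 else 0)" for k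
    unfolding cyclo_def by (simp add: coeff_sum)
  have "coeff (cyclo p) (p * (p - 1)) = (\<Sum>i<p. if i = p - 1 then 1 else 0)"
    unfolding c using p by (intro sum.cong) (auto simp: mult.commute)
  then have top: "coeff (cyclo p) (p * (p - 1)) = 1" using p by simp
  have "coeff (cyclo p) k = 0" if "k > p * (p - 1)" for k
    unfolding c
  proof (intro sum.neutral ballI)
    fix i assume "i \<in> {..<p}"
    then have "p * i \<le> p * (p - 1)" by (intro mult_le_mono) auto
    then have "i * p \<noteq> k" using that by (metis mult.commute not_le)
    then show "(if i * p = k then 1 else 0) = (0 :: int)" by simp
  qed
  then have "degree (cyclo p) \<le> p * (p - 1)" by (intro degree_le) auto
  moreover have "p * (p - 1) \<le> degree (cyclo p)" using top by (intro le_degree) simp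
  ultimately show d: "degree (cyclo p) = p * (p - 1)" by simp
  show "lead_coeff (cyclo p) = 1" using top d by simp
qed

text \<open>A nonzero integer polynomial \<open>q\<close> of least degree vanishing at
  \<open>z\<close> divides a nonzero multiple of \<open>cyclo p\<close>. Eisenstein's criterion,
  after the shift to \<open>X + 1\<close>, makes \<open>q\<close> or its cofactor constant. A
  nonzero constant does not vanish at \<open>z\<close>, and a constant cofactor makes the degree of
  \<open>q\<close> too large.\<close>

lemma int_relation_cyclo_trivial:
  fixes z :: complex
  assumes p: "prime p" and z: "ipoly (cyclo p) z = 0"
    and g: "ipoly g z = 0" "degree g < p * (p - 1)"
  shows "g = 0"
proof (rule ccontr)
  assume "g \<noteq> 0"
  define R where "R = (\<lambda>q. q \<noteq> 0 \<and> ipoly q z = 0)"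
  have p1: "p > 1" using p prime_gt_1_nat by blast
  have "R g" using g \<open>g \<noteq> 0\<close> by (simp add: R_def)
  then obtain q where q: "R q" and qmin: "\<And>r. R r \<Longrightarrow> degree q \<le> degree r"
    using ex_has_least_nat[of R g degree] by blast
  have qd: "degree q < p * (p - 1)" using qmin[OF \<open>R g\<close>] g by simp
  have q0: "q \<noteq> 0" "ipoly q z = 0" using q by (auto simp: R_def)
  \<comment> \<open>Pseudo-division keeps the coefficients integral at the cost of the factor
    \<open>c\<close>; minimality of \<open>q\<close> then forces \<open>r = 0\<close>.\<close>
  define r where "r = pseudo_mod (cyclo p) q"
  obtain c h where c: "c \<noteq> 0" "smult c (cyclo p) = q * h + r"
    using pseudo_mod(1)[OF q0(1)] unfolding r_def by blast
  have r: "r = 0 \<or> degree r < degree q" using pseudo_mod(2)[OF q0(1)] unfolding r_def by blast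
  have "ipoly (smult c (cyclo p)) z = 0" using z by (simp add: map_poly_of_int_smult)
  then have "ipoly r z = 0"
    unfolding c(2) using q0 by (simp add: map_poly_of_int_add map_poly_of_int_mult)
  then have "r = 0" using r qmin[of r] by (force simp: R_def)
  define s where "s = (\<lambda>f :: int poly. pcompose f [:1, 1:])"
  have deg_s: "degree (s f) = degree f" for f by (simp add: s_def degree_pcompose)
  have eq: "smult c (s (cyclo p)) = s q * s h"
    using c(2) \<open>r = 0\<close> by (simp add: s_def flip: pcompose_smult pcompose_mult)
  have dE: "degree (s (cyclo p)) = p * (p - 1)" using degree_cyclo[OF p1] by (simp add: deg_s)
  have coeffs: "int p dvd coeff (s (cyclo p)) i - (if i = p * (p - 1) then 1 else 0)" for i
    unfolding s_def by (rule coeff_cyclo_shift[OF p])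
  have "degree (s q) = 0 \<or> degree (s h) = 0"
  proof (rule eisenstein[OF _ _ _ _ c(1) eq])
    show "prime (int p)" using p by simp
    show "\<not> int p dvd lead_coeff (s (cyclo p))"
    proof
      assume "int p dvd lead_coeff (s (cyclo p))"
      then have "int p dvd 1" using coeffs[of "p * (p - 1)"] unfolding dE
        by (metis (full_types) dvd_diff_right_iff)
      then show False using p1 by simp
    qed
    show "int p dvd coeff (s (cyclo p)) i" if "i < degree (s (cyclo p))" for i
      using coeffs[of i] that dE by simp
    \<comment> \<open>The constant term after the shift is the value of \<open>cyclo p\<close> at 1,
      a sum of \<open>p\<close> ones.\<close>
    have "coeff (s (cyclo p)) 0 = int p"
      by (simp add: s_def cyclo_def poly_sum poly_monom)
    then show "\<not> (int p)\<^sup>2 dvd coeff (s (cyclo p)) 0"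
      using p1 by (simp add: power2_eq_square)
  qed
  then show False
  proof
    assume "degree (s q) = 0"
    then obtain k where "q = [:k:]" by (metis deg_s degree_eq_zeroE)
    then show False using q0 by (simp add: map_poly_pCons)
  next
    assume "degree (s h) = 0"
    moreover have "degree (s h) + degree (s q) = p * (p - 1)"
    proof -
      have "degree (smult c (s (cyclo p))) = p * (p - 1)" using c dE by simp
      moreover have "s q \<noteq> 0" "s h \<noteq> 0"
        using eq c(1) dE qd by auto
      ultimately show ?thesis unfolding eq by (simp add: degree_mult_eq)
    qed
    ultimately show False using qd deg_s by simp
  qed
qed

text \<open>An elementary substitute for Galois conjugation: the remainder of \<open>g\<close>
  modulo the monic \<open>cyclo p\<close> vanishes at \<open>z\<close> and has too small a degree,
  so it is 0.\<close>

lemma ipoly_root_transfer: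
  fixes z w :: complex
  assumes p: "prime p" and z: "ipoly (cyclo p) z = 0" and w: "ipoly (cyclo p) w = 0"
    and g: "ipoly g z = 0"
  shows "ipoly g w = 0"
proof -
  have p1: "p > 1" using p prime_gt_1_nat by blast
  have c0: "cyclo p \<noteq> 0" using lead_coeff_cyclo[OF p1] by auto
  obtain h r where hr: "pseudo_divmod g (cyclo p) = (h, r)" by fastforce
  have g_eq: "g = cyclo p * h + r" and r: "r = 0 \<or> degree r < degree (cyclo p)"
    using pseudo_divmod[OF c0 hr] lead_coeff_cyclo[OF p1] by simp_all
  have "ipoly r z = 0"
    using g z unfolding g_eq by (simp add: map_poly_of_int_add map_poly_of_int_mult)
  then have "r = 0" using r int_relation_cyclo_trivial[OF p z] degree_cyclo[OF p1] by auto
  then show ?thesis using w unfolding g_eq by (simp add: map_poly_of_int_mult)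
qed

section \<open>Orthogonal families of unimodular functions\<close>

text \<open>After expanding the square and summing over \<open>a\<close> first, only the diagonal
  terms \<open>i = j\<close> survive, each equal to \<open>card A\<close>.\<close>

lemma unimodular_parseval:
  fixes u :: "'i \<Rightarrow> 'a \<Rightarrow> complex"
  assumes fin: "finite A" "finite I"
    and norm1: "\<And>i a. i \<in> I \<Longrightarrow> a \<in> A \<Longrightarrow> norm (u i a) = 1"
    and orth: "\<And>i j. i \<in> I \<Longrightarrow> j \<in> I \<Longrightarrow> i \<noteq> j \<Longrightarrow> (\<Sum>a\<in>A. u i a * cnj (u j a)) = 0"
    and a0: "a0 \<in> A"
  shows "(\<Sum>a\<in>A. (norm (\<Sum>i\<in>I. u i a0 * cnj (u i a)))\<^sup>2) = real (card I * card A)"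
proof -
  define S where "S a = (\<Sum>i\<in>I. u i a0 * cnj (u i a))" for a
  have unit: "u i a * cnj (u i a) = 1" if "i \<in> I" "a \<in> A" for i a
    using norm1[OF that] by (simp add: complex_norm_square[symmetric])
  have "(\<Sum>a\<in>A. S a * cnj (S a)) =
      (\<Sum>a\<in>A. \<Sum>i\<in>I. \<Sum>j\<in>I. (u i a0 * cnj (u j a0)) * (u j a * cnj (u i a)))"
    unfolding S_def cnj_sum sum_product by (intro sum.cong refl) (simp add: mult_ac)
  also have "\<dots> = (\<Sum>i\<in>I. \<Sum>a\<in>A. \<Sum>j\<in>I. (u i a0 * cnj (u j a0)) * (u j a * cnj (u i a)))"
    by (rule sum.swap)
  also have "\<dots> = (\<Sum>i\<in>I. \<Sum>j\<in>I. (u i a0 * cnj (u j a0)) * (\<Sum>a\<in>A. u j a * cnj (u i a)))"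
    unfolding sum_distrib_left by (intro sum.cong refl sum.swap)
  also have "\<dots> = (\<Sum>i\<in>I. \<Sum>j\<in>I. if j = i then of_nat (card A) else 0)"
    using orth unit a0 by (intro sum.cong refl) auto
  also have "\<dots> = of_nat (card I * card A)" using fin by simp
  finally have "complex_of_real (\<Sum>a\<in>A. (norm (S a))\<^sup>2) = complex_of_real (card I * card A)"
    by (simp only: of_real_sum complex_norm_square of_real_of_nat_eq)
  then show ?thesis unfolding S_def of_real_eq_iff .
qed

text \<open>The term \<open>a = a0\<close> of the preceding identity is the square of
  \<open>card I\<close>. It cannot exceed \<open>card I * card A\<close>, and equality leaves 0 for
  all other terms.\<close>

lemma unimodular_bessel:
  fixes u :: "'i \<Rightarrow> 'a \<Rightarrow> complex"
  assumes fin: "finite A" "finite I"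
    and norm1: "\<And>i a. i \<in> I \<Longrightarrow> a \<in> A \<Longrightarrow> norm (u i a) = 1"
    and orth: "\<And>i j. i \<in> I \<Longrightarrow> j \<in> I \<Longrightarrow> i \<noteq> j \<Longrightarrow> (\<Sum>a\<in>A. u i a * cnj (u j a)) = 0"
    and a0: "a0 \<in> A"
  shows "card I \<le> card A"
    and "card I = card A \<Longrightarrow> a \<in> A \<Longrightarrow> a \<noteq> a0 \<Longrightarrow> (\<Sum>i\<in>I. u i a0 * cnj (u i a)) = 0"
proof -
  define S where "S a = (\<Sum>i\<in>I. u i a0 * cnj (u i a))" for a
  have unit: "u i a * cnj (u i a) = 1" if "i \<in> I" "a \<in> A" for i a
    using norm1[OF that] by (simp add: complex_norm_square[symmetric])
  have pars: "(\<Sum>a\<in>A. (norm (S a))\<^sup>2) = real (card I * card A)"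
    unfolding S_def by (rule unimodular_parseval[OF assms])
  have "S a0 = of_nat (card I)" unfolding S_def using unit a0 by simp
  moreover have "(\<Sum>a\<in>A. (norm (S a))\<^sup>2) = (norm (S a0))\<^sup>2 + (\<Sum>a\<in>A - {a0}. (norm (S a))\<^sup>2)"
    using fin a0 by (simp add: sum.remove)
  ultimately have eq: "(real (card I))\<^sup>2 + (\<Sum>a\<in>A - {a0}. (norm (S a))\<^sup>2) = real (card I * card A)"
    using pars by simp
  have "(\<Sum>a\<in>A - {a0}. (norm (S a))\<^sup>2) \<ge> 0" by (intro sum_nonneg) simp
  then have "real (card I * card I) \<le> real (card I * card A)" using eq by (simp add: power2_eq_square)
  then have "card I * card I \<le> card I * card A" by (simp only: of_nat_le_iff)
  then show "card I \<le> card A" by (cases "card I = 0") simp_all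
  assume "card I = card A" and a: "a \<in> A" "a \<noteq> a0"
  then have "(\<Sum>a\<in>A - {a0}. (norm (S a))\<^sup>2) = 0" using eq by (simp add: power2_eq_square)
  then have "\<forall>a\<in>A - {a0}. (norm (S a))\<^sup>2 = 0"
    using fin by (subst (asm) sum_nonneg_eq_0_iff) auto
  then show "(\<Sum>i\<in>I. u i a0 * cnj (u i a)) = 0" using a unfolding S_def by auto
qed

section \<open>Spectra characterised by orthogonality and cardinality\<close>

lemma norm_chr: "norm (chr p b a) = 1"
  by (simp add: chr_def norm_exp_eq_Re)

lemma finite_grp: "finite (grp p)" and card_grp: "card (grp p) = p ^ 3"
  by (simp_all add: grp_def card_cartesian_product power2_eq_square power3_eq_cube)

text \<open>Expanding the indicator of one point in the basis yields \<open>card B = card A\<close>.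
  Conversely, equal cardinalities give equality in Bessel's bound, and the dual orthogonality
  obtained from it is Fourier inversion on \<open>A\<close>.\<close>

lemma spectrum_of_iff_card:
  assumes A: "A \<subseteq> grp p" "A \<noteq> {}"
  shows "spectrum_of p A B \<longleftrightarrow> B \<subseteq> grp p \<and> card B = card A \<and>
    (\<forall>b\<in>B. \<forall>b'\<in>B. b \<noteq> b' \<longrightarrow> ip A (chr p b) (chr p b') = 0)"
proof -
  have finA: "finite A" using A finite_grp finite_subset by blast
  then have cA: "card A > 0" using A by (simp add: card_gt_0_iff)
  obtain a0 where a0: "a0 \<in> A" using A by blast
  have unit: "chr p b a * cnj (chr p b a) = 1" for a b
    using norm_chr[of p b a] by (simp add: complex_norm_square[symmetric])
  have proj: "(\<Sum>a\<in>A. (\<Sum>b\<in>B. c b * chr p b a) * cnj (chr p b0 a)) = c b0 * of_nat (card A)"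
    if "finite B" and orth: "\<forall>b\<in>B. \<forall>b'\<in>B. b \<noteq> b' \<longrightarrow> ip A (chr p b) (chr p b') = 0"
      and "b0 \<in> B" for b0 c
  proof -
    have "(\<Sum>a\<in>A. (\<Sum>b\<in>B. c b * chr p b a) * cnj (chr p b0 a)) =
        (\<Sum>a\<in>A. \<Sum>b\<in>B. c b * (chr p b a * cnj (chr p b0 a)))"
      by (simp add: sum_distrib_right mult.assoc)
    also have "\<dots> = (\<Sum>b\<in>B. c b * ip A (chr p b) (chr p b0))"
      unfolding ip_def sum_distrib_left by (rule sum.swap)
    also have "\<dots> = (\<Sum>b\<in>B. if b = b0 then c b0 * of_nat (card A) else 0)"
      using orth that(3) by (intro sum.cong) (auto simp: ip_def unit)
    finally show ?thesis using that by simp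
  qed
  show ?thesis
  proof (intro iffI conjI)
    assume sp: "spectrum_of p A B"
    then have B: "B \<subseteq> grp p"
      and orth: "\<forall>b\<in>B. \<forall>b'\<in>B. b \<noteq> b' \<longrightarrow> ip A (chr p b) (chr p b') = 0"
      unfolding spectrum_of_def by blast+
    have finB: "finite B" using B finite_grp finite_subset by blast
    have span: "\<forall>f :: nat \<times> nat \<Rightarrow> complex. \<exists>c :: nat \<times> nat \<Rightarrow> complex.
        \<forall>a\<in>A. f a = (\<Sum>b\<in>B. c b * chr p b a)"
      using sp unfolding spectrum_of_def by blast
    obtain c where c: "\<And>a. a \<in> A \<Longrightarrow> (if a = a0 then 1 else 0) = (\<Sum>b\<in>B. c b * chr p b a)"
      using span[THEN spec, of "\<lambda>a. if a = a0 then 1 else 0"] by blast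
    \<comment> \<open>Pairing the expansion with \<open>chr p b\<close> isolates one coefficient;
      inserting all of them into the expansion at \<open>a0\<close> counts \<open>B\<close>.\<close>
    have cb: "c b * of_nat (card A) = cnj (chr p b a0)" if "b \<in> B" for b
    proof -
      have "c b * of_nat (card A) = (\<Sum>a\<in>A. (if a = a0 then 1 else 0) * cnj (chr p b a))"
        using proj[OF finB orth that, of c] c by simp
      also have "\<dots> = (\<Sum>a\<in>A. if a = a0 then cnj (chr p b a0) else 0)"
        by (intro sum.cong) auto
      finally show ?thesis using finA a0 by simp
    qed
    have "of_nat (card A) = of_nat (card A) * (\<Sum>b\<in>B. c b * chr p b a0)"
      using c[OF a0] by simp
    also have "\<dots> = (\<Sum>b\<in>B. (c b * of_nat (card A)) * chr p b a0)"
      unfolding sum_distrib_left by (intro sum.cong refl) (simp add: mult_ac)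
    also have "\<dots> = of_nat (card B)"
      using cb unit by (simp add: mult.commute)
    finally show "card B = card A" by simp
    show "B \<subseteq> grp p" "\<forall>b\<in>B. \<forall>b'\<in>B. b \<noteq> b' \<longrightarrow> ip A (chr p b) (chr p b') = 0"
      by fact+
  next
    assume asm: "B \<subseteq> grp p \<and> card B = card A \<and>
      (\<forall>b\<in>B. \<forall>b'\<in>B. b \<noteq> b' \<longrightarrow> ip A (chr p b) (chr p b') = 0)"
    then have B: "B \<subseteq> grp p" and card: "card B = card A"
      and orth: "\<forall>b\<in>B. \<forall>b'\<in>B. b \<noteq> b' \<longrightarrow> ip A (chr p b) (chr p b') = 0" by blast+
    have finB: "finite B" using B finite_grp finite_subset by blast
    have dual: "(\<Sum>b\<in>B. chr p b a * cnj (chr p b a')) = (if a' = a then of_nat (card A) else 0)"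
      if "a \<in> A" "a' \<in> A" for a a'
      using unimodular_bessel(2)[OF finA finB, of "chr p" a a'] norm_chr orth that card unit
      by (auto simp: ip_def)
    show "spectrum_of p A B"
      unfolding spectrum_of_def
    proof (intro conjI B orth allI impI ballI)
      fix c b assume "\<forall>a\<in>A. (\<Sum>b\<in>B. c b * chr p b a) = 0" and b: "b \<in> B"
      then show "c b = 0" using proj[OF finB orth b, of c] cA by simp
    next
      fix f :: "nat \<times> nat \<Rightarrow> complex"
      define c where "c b = (\<Sum>a\<in>A. f a * cnj (chr p b a)) / of_nat (card A)" for b
      have "f a = (\<Sum>b\<in>B. c b * chr p b a)" if "a \<in> A" for a
      proof -
        have "(\<Sum>b\<in>B. c b * chr p b a) =
            (\<Sum>b\<in>B. \<Sum>a'\<in>A. f a' * (chr p b a * cnj (chr p b a'))) / of_nat (card A)"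
          unfolding c_def sum_divide_distrib sum_distrib_right
          by (intro sum.cong refl) (simp add: mult_ac)
        also have "(\<Sum>b\<in>B. \<Sum>a'\<in>A. f a' * (chr p b a * cnj (chr p b a'))) =
            (\<Sum>a'\<in>A. f a' * (\<Sum>b\<in>B. chr p b a * cnj (chr p b a')))"
          unfolding sum_distrib_left by (rule sum.swap)
        also have "\<dots> = (\<Sum>a'\<in>A. if a' = a then f a * of_nat (card A) else 0)"
          using dual that by (intro sum.cong) auto
        finally show ?thesis using finA that cA by auto
      qed
      then show "\<exists>c. \<forall>a\<in>A. f a = (\<Sum>b\<in>B. c b * chr p b a)" by blast
    qed
  qed
qed

section \<open>Vanishing of the Fourier transform\<close>

text \<open>The standard additive character of \<open>Z/p^2\<close>. Characters of
  \<open>Z/p\<close> arise by multiplying the argument by \<open>p\<close>, so one root of unity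
  serves both coordinates.\<close>

definition ee :: "nat \<Rightarrow> int \<Rightarrow> complex" where
  "ee p k = cis (2 * pi * (real_of_int k / real (p\<^sup>2)))"

text \<open>Frequencies are arbitrary integers rather than canonical residues, so that they can be
  subtracted.\<close>

definition van :: "nat \<Rightarrow> (nat \<times> nat) set \<Rightarrow> int \<Rightarrow> int \<Rightarrow> bool" where
  "van p A x y \<longleftrightarrow> (\<Sum>a\<in>A. ee p (x * int (fst a) + int p * (y * int (snd a)))) = 0"

text \<open>An indexed family allows frequencies to be given by integer formulas, without reducing
  them to residues first.\<close>

definition orth :: "nat \<Rightarrow> (nat \<times> nat) set \<Rightarrow> 'i set \<Rightarrow> ('i \<Rightarrow> int) \<Rightarrow> ('i \<Rightarrow> int) \<Rightarrow> bool" where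
  "orth p A I \<beta> \<gamma> \<longleftrightarrow> (\<forall>i\<in>I. \<forall>j\<in>I. i \<noteq> j \<longrightarrow> van p A (\<beta> i - \<beta> j) (\<gamma> i - \<gamma> j))"

lemma ee_add: "ee p (k + l) = ee p k * ee p l"
  by (simp add: ee_def cis_mult add_divide_distrib distrib_left)

lemma ee_0 [simp]: "ee p 0 = 1"
  by (simp add: ee_def)

lemma norm_ee [simp]: "norm (ee p k) = 1"
  by (simp add: ee_def)

lemma cnj_ee: "cnj (ee p k) = ee p (- k)"
  by (simp add: ee_def cis_cnj)

lemma ee_power: "ee p k ^ n = ee p (int n * k)"
  by (induction n) (simp_all add: ee_add algebra_simps)

lemma not_dvd_diff:
  fixes i j :: nat
  assumes "i < n" "j < n" "i \<noteq> j"
  shows "\<not> int n dvd int i - int j"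
proof
  assume "int n dvd int i - int j"
  then have "\<bar>int n\<bar> \<le> \<bar>int i - int j\<bar>" using assms by (intro dvd_imp_le_int) auto
  then show False using assms by linarith
qed

lemma nat_eq_of_dvd_diff: "i < n \<Longrightarrow> j < n \<Longrightarrow> int n dvd int i - int j \<Longrightarrow> i = j"
  using not_dvd_diff by blast

lemma collision:
  assumes "finite S" "f ` B \<subseteq> S" "card S < card B"
  shows "\<exists>b\<in>B. \<exists>b'\<in>B. b \<noteq> b' \<and> f b = f b'"
proof -
  have "card (f ` B) < card B" using assms card_mono le_less_trans by blast
  then have "\<not> inj_on f B" using pigeonhole by blast
  then show ?thesis unfolding inj_on_def by blast
qed

context
  fixes p :: nat
  assumes p: "prime p"
begin

lemma p_gt_1: "p > 1"
  using p prime_gt_1_nat by blast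

lemma prime_int_p: "prime (int p)"
  using p by simp

lemma p_dvd_of_p2_dvd: "int p ^ 2 dvd k \<Longrightarrow> int p dvd k"
  by (metis dvd_triv_left dvd_trans power2_eq_square)

lemma p2_dvd_p_mult_iff: "int p ^ 2 dvd int p * k \<longleftrightarrow> int p dvd k"
  using p_gt_1 by (simp add: power2_eq_square)

lemma ee_eq_1_iff: "ee p k = 1 \<longleftrightarrow> int p ^ 2 dvd k"
proof -
  have p2: "real (p\<^sup>2) \<noteq> 0" using p_gt_1 by simp
  have "ee p k = 1 \<longleftrightarrow> (\<exists>n::int. 2 * pi * (real_of_int k / real (p\<^sup>2)) = of_int n * (2 * pi))"
    unfolding ee_def cis_eq_1_iff by simp
  also have "\<dots> \<longleftrightarrow> (\<exists>n::int. real_of_int k = real_of_int (int p ^ 2 * n))"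
    using p2 by (intro ex_cong1) (auto simp: field_simps)
  also have "\<dots> \<longleftrightarrow> int p ^ 2 dvd k"
    unfolding of_int_eq_iff dvd_def by blast
  finally show ?thesis .
qed

lemma ee_cong: "[k = l] (mod int p ^ 2) \<Longrightarrow> ee p k = ee p l"
proof -
  assume "[k = l] (mod int p ^ 2)"
  then have "ee p (k - l) = 1" by (simp add: ee_eq_1_iff cong_iff_dvd_diff)
  then show ?thesis using ee_add[of p "k - l" l] by simp
qed

lemma sum_ee: "(\<Sum>j<n. ee p (int j * k)) = (if int p ^ 2 dvd k then of_nat n
    else (ee p (int n * k) - 1) / (ee p k - 1))"
proof (cases "int p ^ 2 dvd k")
  case True
  then have "ee p (int j * k) = 1" for j by (simp add: ee_eq_1_iff)
  then show ?thesis using True by simp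
next
  case False
  then have "ee p k \<noteq> 1" by (simp add: ee_eq_1_iff)
  then have "(\<Sum>j<n. ee p k ^ j) = (ee p k ^ n - 1) / (ee p k - 1)" by (simp add: geometric_sum)
  then show ?thesis using False by (simp add: ee_power)
qed

text \<open>By the geometric series, the sum vanishes precisely when \<open>ee p k\<close> has order
  exactly \<open>p\<close>.\<close>

lemma sum_ee_p_eq_0_iff:
  "(\<Sum>j<p. ee p (int j * k)) = 0 \<longleftrightarrow> int p dvd k \<and> \<not> int p ^ 2 dvd k"
proof -
  have "int p ^ 2 dvd int p * k \<longleftrightarrow> int p dvd k" using p_gt_1 by (simp add: power2_eq_square)
  then show ?thesis using p_gt_1 by (simp add: sum_ee ee_eq_1_iff)
qed

lemma sum_ee_p2_eq_0_iff:
  "(\<Sum>j<p\<^sup>2. ee p (int j * k)) = 0 \<longleftrightarrow> \<not> int p ^ 2 dvd k"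
  using p_gt_1 by (simp add: sum_ee ee_eq_1_iff)

text \<open>The \<open>p\<close>-th power of \<open>ee p k\<close> is a nontrivial
  \<open>p\<close>-th root of unity, whose \<open>p\<close> powers sum to 0.\<close>

lemma ipoly_cyclo_ee: "\<not> int p dvd k \<Longrightarrow> ipoly (cyclo p) (ee p k) = 0"
proof -
  assume k: "\<not> int p dvd k"
  have "ipoly (cyclo p) (ee p k) = (\<Sum>i<p. ee p (int i * (int p * k)))"
    unfolding cyclo_def ipoly_monom_sum by (simp add: ee_power mult_ac)
  also have "\<dots> = 0" unfolding sum_ee_p_eq_0_iff using k p_gt_1 by (simp add: power2_eq_square)
  finally show ?thesis .
qed

section \<open>Invariance of the vanishing frequencies under units\<close>

lemma cong_mult_p: "[a = b] (mod int p) \<Longrightarrow> [int p * a = int p * b] (mod int p ^ 2)"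
  by (simp add: cong_iff_dvd_diff power2_eq_square flip: right_diff_distrib)

lemma van_cong:
  assumes "[x = x'] (mod int p ^ 2)" "[y = y'] (mod int p)"
  shows "van p A x y \<longleftrightarrow> van p A x' y'"
proof -
  have "[int p * (y * c) = int p * (y' * c)] (mod int p ^ 2)" for c
    using cong_mult_p[OF cong_scalar_right[OF assms(2)]] .
  then have "ee p (x * b + int p * (y * c)) = ee p (x' * b + int p * (y' * c))" for b c
    using assms(1) by (intro ee_cong cong_add cong_scalar_right)
  then show ?thesis by (simp add: van_def)
qed

text \<open>All primitive \<open>p\<^sup>2\<close>-th roots of unity satisfy the same integer relations.\<close>

lemma van_mult:
  assumes k: "\<not> int p dvd k" and A: "van p A x y"
  shows "van p A (k * x) (k * y)"
proof -
  \<comment> \<open>Natural exponents reduced modulo \<open>p^2\<close> turn the exponential sum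
    into an integer polynomial \<open>g\<close>, whose value at \<open>ee p k\<close> is the sum for
    the frequency \<open>(k * x, k * y)\<close>.\<close>
  define n where "n a = nat ((x * int (fst a) + int p * (y * int (snd a))) mod int p ^ 2)"
    for a :: "nat \<times> nat"
  define g :: "int poly" where "g = (\<Sum>a\<in>A. monom 1 (n a))"
  have n: "[int (n a) = x * int (fst a) + int p * (y * int (snd a))] (mod int p ^ 2)" for a
    using p_gt_1 by (simp add: n_def)
  have eval: "ipoly g (ee p l) = (\<Sum>a\<in>A. ee p ((l * x) * int (fst a) + int p * ((l * y) * int (snd a))))" for l
    unfolding g_def ipoly_monom_sum
  proof (intro sum.cong refl)
    fix a
    have "[int (n a) * l = (l * x) * int (fst a) + int p * ((l * y) * int (snd a))] (mod int p ^ 2)"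
      using cong_scalar_right[OF n[of a], of l] by (simp add: algebra_simps)
    then show "of_int 1 * ee p l ^ n a = ee p ((l * x) * int (fst a) + int p * ((l * y) * int (snd a)))"
      by (simp add: ee_power ee_cong)
  qed
  have "ipoly g (ee p 1) = 0" using A by (simp add: eval van_def)
  moreover have "\<not> int p dvd 1" using p_gt_1 by simp
  ultimately have "ipoly g (ee p k) = 0"
    using ipoly_root_transfer[OF p] ipoly_cyclo_ee k by blast
  then show ?thesis by (simp add: eval van_def)
qed

lemma inverse_mod_p2:
  assumes "\<not> int p dvd x"
  obtains k where "[x * k = 1] (mod int p ^ 2)" "[x * k = 1] (mod int p)" "\<not> int p dvd k"
proof -
  have "coprime x (int p ^ 2)"
    using assms prime_int_p prime_imp_coprime by (metis coprime_commute coprime_power_right_iff)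
  then obtain k where k: "[x * k = 1] (mod int p ^ 2)" using cong_solve_coprime_int by blast
  then have k': "[x * k = 1] (mod int p)"
    by (rule cong_dvd_modulus) (simp add: power2_eq_square)
  have "\<not> int p dvd k"
  proof
    assume "int p dvd k"
    then have "int p dvd 1" using k' by (metis cong_dvd_iff dvd_mult)
    then show False using p_gt_1 by simp
  qed
  then show ?thesis using that k k' by blast
qed

text \<open>The inverse of \<open>k\<close> modulo \<open>p^2\<close> is again a unit and gives the
  reverse direction.\<close>

lemma van_unit_multiple_iff:
  assumes k: "\<not> int p dvd k" and "[k * x = x'] (mod int p ^ 2)" "[k * y = y'] (mod int p)"
  shows "van p A x' y' \<longleftrightarrow> van p A x y"
proof
  assume "van p A x y"
  then show "van p A x' y'" using van_mult[OF k] van_cong[OF assms(2,3)] by blast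
next
  assume A: "van p A x' y'"
  obtain l where l: "[k * l = 1] (mod int p ^ 2)" "[k * l = 1] (mod int p)" "\<not> int p dvd l"
    using inverse_mod_p2[OF k] .
  have "[l * x' = x] (mod int p ^ 2)"
  proof -
    have "[l * x' = l * (k * x)] (mod int p ^ 2)" using assms(2) by (intro cong_scalar_left) (rule cong_sym)
    also have "l * (k * x) = (k * l) * x" by simp
    also have "[(k * l) * x = 1 * x] (mod int p ^ 2)" using l(1) by (rule cong_scalar_right)
    finally show ?thesis by simp
  qed
  moreover have "[l * y' = y] (mod int p)"
  proof -
    have "[l * y' = l * (k * y)] (mod int p)" using assms(3) by (intro cong_scalar_left) (rule cong_sym)
    also have "l * (k * y) = (k * l) * y" by simp
    also have "[(k * l) * y = 1 * y] (mod int p)" using l(2) by (rule cong_scalar_right)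
    finally show ?thesis by simp
  qed
  ultimately show "van p A x y" using van_mult[OF l(3) A] van_cong by blast
qed

text \<open>Up to unit multiples the nonzero frequencies are \<open>(1, v)\<close>, \<open>(p, 0)\<close> and \<open>(p u, 1)\<close>.\<close>

lemma van_unit_iff:
  assumes "\<not> int p dvd x" "[x * v = y] (mod int p)"
  shows "van p A x y \<longleftrightarrow> van p A 1 v"
  using van_unit_multiple_iff[OF assms(1), of 1 x v y] assms(2) by simp

lemma van_p0_iff:
  assumes "\<not> int p dvd t" "int p dvd y"
  shows "van p A (int p * t) y \<longleftrightarrow> van p A (int p) 0"
  using van_unit_multiple_iff[OF assms(1), of "int p" "int p * t" 0 y] assms(2)
  by (simp add: mult.commute cong_0_iff cong_sym_eq[of 0])

lemma van_pu1_iff: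
  assumes "\<not> int p dvd y" "[y * u = t] (mod int p)"
  shows "van p A (int p * t) y \<longleftrightarrow> van p A (int p * u) 1"
  using van_unit_multiple_iff[OF assms(1), of "int p * u" "int p * t" 1 y] cong_mult_p[OF assms(2)]
  by (simp add: mult.left_commute)

lemma solve_mod_p:
  assumes "\<not> int p dvd x"
  obtains v where "[x * v = y] (mod int p)"
proof -
  obtain k where "[x * k = 1] (mod int p)" using inverse_mod_p2[OF assms] .
  then have "[x * k * y = 1 * y] (mod int p)" by (rule cong_scalar_right)
  then show ?thesis using that[of "k * y"] by (simp add: mult.assoc)
qed

text \<open>The frequency is a unit multiple of some \<open>(1, v)\<close> if \<open>p\<close> does
  not divide \<open>x\<close>, of some \<open>(p u, 1)\<close> if \<open>p\<close> divides
  \<open>x\<close> but not \<open>y\<close>, and of \<open>(p, 0)\<close> otherwise.\<close>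

lemma van_all:
  assumes "van p A (int p) 0" "\<And>u. van p A (int p * u) 1" "\<And>v. van p A 1 v"
    and "\<not> (int p ^ 2 dvd x \<and> int p dvd y)"
  shows "van p A x y"
proof (cases "int p dvd x")
  case False
  then show ?thesis using assms(3) van_unit_iff solve_mod_p by metis
next
  case True
  then obtain t where t: "x = int p * t" by blast
  show ?thesis
  proof (cases "int p dvd y")
    case True
    then have "\<not> int p dvd t" using assms(4) t p_gt_1 by (auto simp: power2_eq_square)
    then show ?thesis using assms(1) t True van_p0_iff by blast
  next
    case False
    then show ?thesis using assms(2) t van_pu1_iff solve_mod_p by metis
  qed
qed

section \<open>Orthogonal families of characters and translational tilings\<close>

lemma chr_eq_ee: "chr p b a = ee p (int (fst b) * int (fst a) + int p * (int (snd b) * int (snd a)))"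
proof -
  have p0: "real p \<noteq> 0" using p_gt_1 by simp
  have "real (fst a * fst b) / real (p\<^sup>2) + real (snd a * snd b) / real p =
      real_of_int (int (fst b) * int (fst a) + int p * (int (snd b) * int (snd a))) / real (p\<^sup>2)"
    using p0 by (simp add: field_simps power2_eq_square)
  then show ?thesis unfolding chr_def ee_def cis_conv_exp by (simp add: mult_ac)
qed

lemma ip_chr_eq_0_iff:
  "ip A (chr p b) (chr p b') = 0 \<longleftrightarrow>
    van p A (int (fst b) - int (fst b')) (int (snd b) - int (snd b'))"
  by (simp add: ip_def van_def chr_eq_ee cnj_ee ee_add[symmetric] algebra_simps)

lemma van_0_0: "finite A \<Longrightarrow> van p A 0 0 \<longleftrightarrow> A = {}"
  by (simp add: van_def)

context
  fixes A :: "(nat \<times> nat) set" and I :: "'i set" and \<beta> \<gamma> :: "'i \<Rightarrow> int"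
  assumes A: "finite A" "A \<noteq> {}" and I: "finite I" and orth: "orth p A I \<beta> \<gamma>"
begin

lemma orth_sum_eq_0:
  assumes "i \<in> I" "j \<in> I" "i \<noteq> j"
  shows "(\<Sum>a\<in>A. ee p (\<beta> i * int (fst a) + int p * (\<gamma> i * int (snd a))) *
    cnj (ee p (\<beta> j * int (fst a) + int p * (\<gamma> j * int (snd a))))) = 0"
proof -
  have "van p A (\<beta> i - \<beta> j) (\<gamma> i - \<gamma> j)" using orth assms unfolding orth_def by blast
  then show ?thesis by (simp add: van_def cnj_ee ee_add[symmetric] algebra_simps)
qed

lemma orth_card_le: "card I \<le> card A"
proof -
  obtain a0 where "a0 \<in> A" using A by blast
  then show ?thesis
    using unimodular_bessel(1)[OF A(1) I _ orth_sum_eq_0] by simp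
qed

lemma orth_complete:
  assumes "card I = card A" "a \<in> A" "a' \<in> A" "a \<noteq> a'"
  shows "(\<Sum>i\<in>I. ee p (\<beta> i * (int (fst a) - int (fst a')) + int p * (\<gamma> i * (int (snd a) - int (snd a'))))) = 0"
proof -
  have "(\<Sum>i\<in>I. ee p (\<beta> i * int (fst a) + int p * (\<gamma> i * int (snd a))) *
      cnj (ee p (\<beta> i * int (fst a') + int p * (\<gamma> i * int (snd a'))))) = 0"
    using unimodular_bessel(2)[OF A(1) I,
        where u = "\<lambda>i a. ee p (\<beta> i * int (fst a) + int p * (\<gamma> i * int (snd a)))"]
      orth_sum_eq_0 assms by simp
  then show ?thesis by (simp add: cnj_ee ee_add[symmetric] algebra_simps)
qed

text \<open>Reduction to canonical residues keeps the frequencies distinct: a coincidence would give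
  \<open>van p A 0 0\<close>, which fails for nonempty \<open>A\<close>.\<close>

lemma orth_imp_spectral:
  assumes sub: "A \<subseteq> grp p" and card: "card I = card A"
  shows "spectral_set p A"
proof -
  have p1: "int p > 0" using p_gt_1 by simp
  define r where "r i = (nat (\<beta> i mod int p ^ 2), nat (\<gamma> i mod int p))" for i
  have r: "[int (fst (r i)) = \<beta> i] (mod int p ^ 2)" "[int (snd (r i)) = \<gamma> i] (mod int p)" for i
    using p1 by (simp_all add: r_def)
  have van_r: "van p A (int (fst (r i)) - int (fst (r j))) (int (snd (r i)) - int (snd (r j)))"
    if "i \<in> I" "j \<in> I" "i \<noteq> j" for i j
  proof -
    have "van p A (\<beta> i - \<beta> j) (\<gamma> i - \<gamma> j)" using orth that unfolding orth_def by blast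
    then show ?thesis
      using van_cong[OF cong_diff[OF r(1)[of i] r(1)[of j]] cong_diff[OF r(2)[of i] r(2)[of j]]]
      by blast
  qed
  have "inj_on r I"
  proof (rule inj_onI, rule ccontr)
    fix i j assume "i \<in> I" "j \<in> I" "r i = r j" "i \<noteq> j"
    then show False using van_r[of i j] A van_0_0 by simp
  qed
  then have "card (r ` I) = card A" using card by (simp add: card_image)
  moreover have "r ` I \<subseteq> grp p"
    using p1 by (auto simp: r_def grp_def nat_less_iff)
  moreover have "\<forall>b\<in>r ` I. \<forall>b'\<in>r ` I. b \<noteq> b' \<longrightarrow> ip A (chr p b) (chr p b') = 0"
    using van_r by (auto simp: ip_chr_eq_0_iff)
  ultimately have "spectrum_of p A (r ` I)" using spectrum_of_iff_card[OF sub A(2)] by blast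
  then show ?thesis unfolding spectral_set_def using sub A by blast
qed

end

lemma spectral_imp_orth:
  assumes "spectral_set p A"
  obtains B where "B \<subseteq> grp p" "card B = card A" "orth p A B (\<lambda>b. int (fst b)) (\<lambda>b. int (snd b))"
proof -
  have A: "A \<subseteq> grp p" "A \<noteq> {}" using assms unfolding spectral_set_def by blast+
  obtain B where "spectrum_of p A B" using assms unfolding spectral_set_def by blast
  then show ?thesis using that[of B] spectrum_of_iff_card[OF A] by (simp add: orth_def ip_chr_eq_0_iff)
qed

section \<open>Explicit orthogonal families of frequencies\<close>

lemma orth_line:
  assumes "van p A x y"
  shows "orth p A {..<p} (\<lambda>j. int j * x) (\<lambda>j. int j * y)"
  unfolding orth_def
proof (intro ballI impI)
  fix i j assume "i \<in> {..<p}" "j \<in> {..<p}" "i \<noteq> j"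
  \<comment> \<open>Distinct indices below \<open>p\<close> differ by a unit, so each difference of
    frequencies is a unit multiple of \<open>(x, y)\<close>.\<close>
  then have "\<not> int p dvd int i - int j" by (intro not_dvd_diff) auto
  from van_mult[OF this assms]
  show "van p A (int i * x - int j * x) (int i * y - int j * y)" by (simp add: left_diff_distrib)
qed

text \<open>The frequencies form the \<open>p\<close>-torsion subgroup; its nonzero elements are
  unit multiples of \<open>(p, 0)\<close> or of some \<open>(p u, 1)\<close>.\<close>

lemma orth_order_p_subgroup:
  assumes "van p A (int p) 0" "\<And>u. van p A (int p * u) 1"
  shows "orth p A ({..<p} \<times> {..<p}) (\<lambda>i. int p * int (fst i)) (\<lambda>i. int (snd i))"
  unfolding orth_def
proof (intro ballI impI)
  fix i j :: "nat \<times> nat"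
  assume ij: "i \<in> {..<p} \<times> {..<p}" "j \<in> {..<p} \<times> {..<p}" "i \<noteq> j"
  have "van p A (int p * (int (fst i) - int (fst j))) (int (snd i) - int (snd j))"
  proof (cases "snd i = snd j")
    case True
    then have "\<not> int p dvd int (fst i) - int (fst j)"
      using ij by (intro not_dvd_diff) (auto simp: prod_eq_iff)
    then show ?thesis using van_p0_iff assms(1) True by simp
  next
    case False
    then have nd: "\<not> int p dvd int (snd i) - int (snd j)" using ij by (intro not_dvd_diff) auto
    obtain u where "[(int (snd i) - int (snd j)) * u = int (fst i) - int (fst j)] (mod int p)"
      using solve_mod_p[OF nd] .
    then show ?thesis using van_pu1_iff[OF nd] assms(2) by blast
  qed
  then show "van p A (int p * int (fst i) - int p * int (fst j)) (int (snd i) - int (snd j))"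
    by (simp add: right_diff_distrib)
qed

text \<open>The frequencies form the cyclic group generated by \<open>(1, v)\<close>. A nonzero
  multiple by \<open>d\<close> is a unit multiple of \<open>(1, v)\<close> if \<open>p\<close> does
  not divide \<open>d\<close>, and of \<open>(p, 0)\<close> otherwise.\<close>

lemma orth_cyclic_p2:
  assumes "van p A (int p) 0" "van p A 1 v"
  shows "orth p A {..<p\<^sup>2} int (\<lambda>i. int i * v)"
  unfolding orth_def
proof (intro ballI impI)
  fix i j assume ij: "i \<in> {..<p\<^sup>2}" "j \<in> {..<p\<^sup>2}" "i \<noteq> j"
  define d where "d = int i - int j"
  have d2: "\<not> int p ^ 2 dvd d" using ij not_dvd_diff[of i "p\<^sup>2" j] by (simp add: d_def)
  have "van p A d (d * v)"
  proof (cases "int p dvd d")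
    case True
    then obtain t where t: "d = int p * t" by blast
    then have "\<not> int p dvd t" using d2 by (auto simp: power2_eq_square)
    then show ?thesis using van_p0_iff assms(1) t by simp
  next
    case False
    then show ?thesis using van_unit_iff[OF False, of v "d * v"] assms(2) by simp
  qed
  then show "van p A (int i - int j) (int i * v - int j * v)" by (simp add: d_def left_diff_distrib)
qed

lemma orth_transversal:
  assumes "\<And>v. van p A 1 v" "van p A (int p * u) 1"
  shows "orth p A ({..<p} \<times> {..<p}) (\<lambda>i. int (fst i) + int p * (u * int (snd i))) (\<lambda>i. int (snd i))"
  unfolding orth_def
proof (intro ballI impI)
  fix i j :: "nat \<times> nat"
  assume ij: "i \<in> {..<p} \<times> {..<p}" "j \<in> {..<p} \<times> {..<p}" "i \<noteq> j"
  define d e where "d = int (fst i) - int (fst j)" and "e = int (snd i) - int (snd j)"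
  have "van p A (d + int p * (u * e)) e"
  proof (cases "fst i = fst j")
    case True
    then have "\<not> int p dvd e"
      using ij unfolding e_def by (intro not_dvd_diff) (auto simp: prod_eq_iff)
    then show ?thesis using van_pu1_iff[of e u "u * e"] assms(2) True by (simp add: d_def mult.commute)
  next
    case False
    then have "\<not> int p dvd d" using ij unfolding d_def by (intro not_dvd_diff) auto
    then have "\<not> int p dvd d + int p * (u * e)" by (simp add: dvd_add_left_iff)
    then show ?thesis using van_unit_iff solve_mod_p assms(1) by metis
  qed
  then show "van p A (int (fst i) + int p * (u * int (snd i)) - (int (fst j) + int p * (u * int (snd j))))
      (int (snd i) - int (snd j))"
    by (simp add: d_def e_def algebra_simps)
qed

lemma orth_all:
  assumes "\<And>x y. \<not> (int p ^ 2 dvd x \<and> int p dvd y) \<Longrightarrow> van p A x y"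
  shows "orth p A (grp p) (\<lambda>b. int (fst b)) (\<lambda>b. int (snd b))"
  unfolding orth_def
proof (intro ballI impI assms notI)
  fix i j assume ij: "i \<in> grp p" "j \<in> grp p" "i \<noteq> j"
    and dvd: "int p ^ 2 dvd int (fst i) - int (fst j) \<and> int p dvd int (snd i) - int (snd j)"
  have "fst i = fst j" using ij dvd not_dvd_diff[of "fst i" "p\<^sup>2" "fst j"] by (auto simp: grp_def)
  moreover have "snd i = snd j" using ij dvd not_dvd_diff[of "snd i" p "snd j"] by (auto simp: grp_def)
  ultimately show False using ij by (simp add: prod_eq_iff)
qed

section \<open>Product sums and tiling complements\<close>

lemma sum_ee_prod:
  "(\<Sum>i\<in>{..<m} \<times> {..<n}. ee p (int (fst i) * k + int (snd i) * l)) =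
    (\<Sum>i<m. ee p (int i * k)) * (\<Sum>j<n. ee p (int j * l))"
  by (simp add: sum_product sum.cartesian_product ee_add case_prod_beta)

lemma grp_eqI:
  assumes "a \<in> grp p" "a' \<in> grp p"
    and "[int (fst a) = int (fst a')] (mod int p ^ 2)" "[int (snd a) = int (snd a')] (mod int p)"
  shows "a = a'"
proof (rule prod_eqI; rule ccontr)
  assume "fst a \<noteq> fst a'"
  then show False
    using assms not_dvd_diff[of "fst a" "p\<^sup>2" "fst a'"] by (auto simp: grp_def cong_iff_dvd_diff)
next
  assume "snd a \<noteq> snd a'"
  then show False
    using assms not_dvd_diff[of "snd a" p "snd a'"] by (auto simp: grp_def cong_iff_dvd_diff)
qed

text \<open>The cardinalities match that of the group, so injectivity of addition already makes it
  bijective.\<close>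

lemma tile_of_family:
  fixes \<tau> \<sigma> :: "'i \<Rightarrow> int"
  assumes A: "A \<subseteq> grp p" and I: "finite I" and card: "card A * card I = p ^ 3"
    and inj: "\<And>a a' i i'. \<lbrakk>a \<in> A; a' \<in> A; i \<in> I; i' \<in> I;
      [int (fst a) + \<tau> i = int (fst a') + \<tau> i'] (mod int p ^ 2);
      [int (snd a) + \<sigma> i = int (snd a') + \<sigma> i'] (mod int p)\<rbrakk> \<Longrightarrow> a = a' \<and> i = i'"
  shows "is_tile p A"
proof -
  have p0: "int p > 0" using p_gt_1 by simp
  define r where "r i = (nat (\<tau> i mod int p ^ 2), nat (\<sigma> i mod int p))" for i
  have r: "[int (fst (r i)) = \<tau> i] (mod int p ^ 2)" "[int (snd (r i)) = \<sigma> i] (mod int p)" for i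
    using p0 by (simp_all add: r_def)
  have rG: "r i \<in> grp p" for i
    using p0 by (auto simp: r_def grp_def nat_less_iff)
  define s where "s = (\<lambda>(a, i). gadd p a (r i))"
  have s: "[int (fst (s (a, i))) = int (fst a) + \<tau> i] (mod int p ^ 2)"
    "[int (snd (s (a, i))) = int (snd a) + \<sigma> i] (mod int p)" for a i
    using cong_add[OF cong_refl r(1)[of i]] cong_add[OF cong_refl r(2)[of i]]
    by (simp_all add: s_def gadd_def zmod_int)
  have inj_s: "inj_on s (A \<times> I)"
  proof (rule inj_onI, clarify)
    fix a i a' i' assume *: "a \<in> A" "i \<in> I" "a' \<in> A" "i' \<in> I" "s (a, i) = s (a', i')"
    have "[int (fst a) + \<tau> i = int (fst a') + \<tau> i'] (mod int p ^ 2)"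
      using s(1)[of a i] s(1)[of a' i'] *(5) by (metis cong_sym cong_trans)
    moreover have "[int (snd a) + \<sigma> i = int (snd a') + \<sigma> i'] (mod int p)"
      using s(2)[of a i] s(2)[of a' i'] *(5) by (metis cong_sym cong_trans)
    ultimately show "a = a' \<and> i = i'" using inj * by blast
  qed
  have "s ` (A \<times> I) \<subseteq> grp p"
    using p_gt_1 by (auto simp: s_def gadd_def grp_def)
  moreover have "card (s ` (A \<times> I)) = card (grp p)"
    using inj_s card by (simp add: card_image card_cartesian_product card_grp)
  ultimately have surj: "s ` (A \<times> I) = grp p" using finite_grp card_subset_eq by blast
  have "\<exists>!x. fst x \<in> A \<and> snd x \<in> r ` I \<and> g = gadd p (fst x) (snd x)" if g: "g \<in> grp p" for g
  proof -
    obtain a i where ai: "a \<in> A" "i \<in> I" "g = s (a, i)" using g surj by blast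
    show ?thesis
    proof (rule ex1I[of _ "(a, r i)"])
      show "fst (a, r i) \<in> A \<and> snd (a, r i) \<in> r ` I \<and> g = gadd p (fst (a, r i)) (snd (a, r i))"
        using ai by (simp add: s_def)
      fix x assume x: "fst x \<in> A \<and> snd x \<in> r ` I \<and> g = gadd p (fst x) (snd x)"
      then obtain i' where i': "i' \<in> I" "snd x = r i'" by blast
      then have "s (fst x, i') = s (a, i)" using x ai by (simp add: s_def)
      then have "(fst x, i') = (a, i)" using inj_onD[OF inj_s] x ai i' by blast
      then show "x = (a, r i)" using i' by (simp add: prod_eq_iff)
    qed
  qed
  moreover have "r ` I \<subseteq> grp p" using rG by blast
  ultimately show ?thesis unfolding is_tile_def using A by (intro conjI exI[of _ "r ` I"] ballI)
qed

text \<open>The product of the transforms of \<open>A\<close> and \<open>T\<close> is the transform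
  of the whole group, which vanishes at every nonzero frequency.\<close>

lemma tile_complement:
  assumes "is_tile p A"
  obtains T where "T \<subseteq> grp p" "card A * card T = p ^ 3"
    "\<And>x y. \<not> (int p ^ 2 dvd x \<and> int p dvd y) \<Longrightarrow> van p A x y \<or> van p T x y"
proof -
  have A: "A \<subseteq> grp p" using assms unfolding is_tile_def by blast
  obtain T where T: "T \<subseteq> grp p"
    and uniq': "\<forall>g\<in>grp p. \<exists>!x. fst x \<in> A \<and> snd x \<in> T \<and> g = gadd p (fst x) (snd x)"
    using assms unfolding is_tile_def by (elim conjE exE)
  note uniq = bspec[OF uniq']
  define s where "s = (\<lambda>(a, t). gadd p a t)"
  have sG: "s x \<in> grp p" for x
    using p_gt_1 by (auto simp: s_def gadd_def grp_def case_prod_beta)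
  have bij: "bij_betw s (A \<times> T) (grp p)"
    unfolding bij_betw_def
  proof
    show "inj_on s (A \<times> T)"
    proof (rule inj_onI)
      fix x y assume "x \<in> A \<times> T" "y \<in> A \<times> T" "s x = s y"
      then show "x = y"
        using ex1E[OF uniq[OF sG[of x]]] unfolding s_def case_prod_beta mem_Times_iff by metis
    qed
    show "s ` (A \<times> T) = grp p"
    proof
      show "grp p \<subseteq> s ` (A \<times> T)"
      proof
        fix g assume "g \<in> grp p"
        then obtain x where "fst x \<in> A \<and> snd x \<in> T \<and> g = gadd p (fst x) (snd x)"
          using ex1_implies_ex[OF uniq] by blast
        then show "g \<in> s ` (A \<times> T)" by (intro image_eqI[of _ _ x]) (auto simp: s_def case_prod_beta mem_Times_iff)
      qed
    qed (use sG in blast)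
  qed
  have "card A * card T = p ^ 3"
    using bij_betw_same_card[OF bij] by (simp add: card_cartesian_product card_grp)
  moreover have "van p A x y \<or> van p T x y" if nz: "\<not> (int p ^ 2 dvd x \<and> int p dvd y)" for x y
  proof -
    define f where "f a = ee p (x * int (fst a) + int p * (y * int (snd a)))" for a :: "nat \<times> nat"
    have f_s: "f (s (a, t)) = f a * f t" for a t
    proof -
      have 1: "[int (fst (s (a, t))) = int (fst a) + int (fst t)] (mod int p ^ 2)"
        and 2: "[int (snd (s (a, t))) = int (snd a) + int (snd t)] (mod int p)"
        by (simp_all add: s_def gadd_def zmod_int)
      have "[x * int (fst (s (a, t))) + int p * (y * int (snd (s (a, t)))) =
          x * (int (fst a) + int (fst t)) + int p * (y * (int (snd a) + int (snd t)))] (mod int p ^ 2)"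
        by (intro cong_add cong_scalar_left 1 cong_mult_p 2)
      then have "f (s (a, t)) = ee p (x * (int (fst a) + int (fst t)) + int p * (y * (int (snd a) + int (snd t))))"
        unfolding f_def by (rule ee_cong)
      then show ?thesis by (simp add: f_def ee_add[symmetric] algebra_simps)
    qed
    have "(\<Sum>a\<in>A. f a) * (\<Sum>t\<in>T. f t) = (\<Sum>x\<in>A \<times> T. f (s x))"
      by (simp add: sum_product sum.cartesian_product f_s case_prod_beta)
        (simp add: f_s[symmetric])
    also have "\<dots> = (\<Sum>g\<in>grp p. f g)" by (rule sum.reindex_bij_betw[OF bij])
    also have "\<dots> = (\<Sum>i\<in>{..<p\<^sup>2} \<times> {..<p}. ee p (int (fst i) * x + int (snd i) * (int p * y)))"
      unfolding f_def grp_def lessThan_atLeast0 by (intro sum.cong refl) (simp add: mult_ac)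
    also have "\<dots> = (\<Sum>i<p\<^sup>2. ee p (int i * x)) * (\<Sum>j<p. ee p (int j * (int p * y)))"
      by (rule sum_ee_prod)
    also have "\<dots> = 0"
      \<comment> \<open>The first factor vanishes if \<open>p^2\<close> does not divide
        \<open>x\<close>, the second if \<open>p\<close> does not divide \<open>y\<close>.\<close>
      unfolding mult_eq_0_iff sum_ee_p_eq_0_iff sum_ee_p2_eq_0_iff
      using nz p_gt_1 by (auto simp: power2_eq_square)
    finally show ?thesis by (simp add: van_def f_def)
  qed
  ultimately show ?thesis using that T by blast
qed

section \<open>Tiles are spectral\<close>

lemma tile_imp_spectral:
  assumes tile: "is_tile p A"
  shows "spectral_set p A"
proof -
  have p1: "p > 1" using p_gt_1 .
  have A: "A \<subseteq> grp p" using tile unfolding is_tile_def by blast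
  obtain T where T: "T \<subseteq> grp p" and card: "card A * card T = p ^ 3"
    and van: "\<And>x y. \<not> (int p ^ 2 dvd x \<and> int p dvd y) \<Longrightarrow> van p A x y \<or> van p T x y"
    using tile_complement[OF tile] by blast
  have fin: "finite A" "finite T" using A T finite_grp finite_subset by blast+
  have ne: "A \<noteq> {}" "T \<noteq> {}" using card p1 by auto
  note spectral = orth_imp_spectral[OF fin(1) ne(1) _ _ A]
  note bessel = orth_card_le[OF fin(2) ne(2)]
  have van_p0: "van p A (int p) 0 \<or> van p T (int p) 0"
    using p1 by (intro van) (auto simp: power2_eq_square)
  have van_pu1: "van p A (int p * u) 1 \<or> van p T (int p * u) 1" for u
    using p1 by (intro van) auto
  have van_1v: "van p A 1 v \<or> van p T 1 v" for v
    using p1 by (intro van) (auto simp: power2_eq_1_iff)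
  have p_less: "p < p ^ 2" "p ^ 2 < p ^ 3" using p1 by (simp_all add: power2_eq_square power3_eq_cube)
  have "card A dvd p ^ 3" using card by (metis dvd_triv_left)
  then obtain k where k: "k \<le> 3" "card A = p ^ k" using divides_primepow_nat[OF p] by blast
  then consider "card A = 1" | "card A = p" | "card A = p ^ 2" | "card A = p ^ 3"
    by (metis One_nat_def le_Suc_eq le_zero_eq numeral_2_eq_2 numeral_3_eq_3 power_0 power_one_right)
  then show ?thesis
  proof cases
    case 1
    have "orth p A {()} (\<lambda>_. 0) (\<lambda>_. 0)" by (simp add: orth_def)
    from spectral[OF _ this] show ?thesis using 1 by simp
  next
    case 2
    then have "card T = p ^ 2" using card p1 by (simp add: power2_eq_square power3_eq_cube)
    \<comment> \<open>Vanishing of \<open>T\<close> at every nonzero frequency would require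
      \<open>p^3\<close> elements in \<open>T\<close>.\<close>
    then have "\<not> orth p T (grp p) (\<lambda>b. int (fst b)) (\<lambda>b. int (snd b))"
      using bessel[OF finite_grp] p_less by (fastforce simp: card_grp)
    then obtain x y where "\<not> (int p ^ 2 dvd x \<and> int p dvd y)" "\<not> van p T x y"
      using orth_all by blast
    then have "van p A x y" using van by blast
    from spectral[OF _ orth_line[OF this]] show ?thesis using 2 by simp
  next
    case 3
    then have cT: "card T < p ^ 2" using card p1 by (simp add: power2_eq_square power3_eq_cube)
    have I: "finite ({..<p} \<times> {..<p})" "card ({..<p} \<times> {..<p}) = p ^ 2"
      by (simp_all add: card_cartesian_product power2_eq_square)
    \<comment> \<open>\<open>T\<close> has only \<open>p\<close> elements, so none of the three
      explicit families of \<open>p^2\<close> frequencies is orthogonal on it.\<close>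
    have no_sub: "\<not> (van p T (int p) 0 \<and> (\<forall>u. van p T (int p * u) 1))"
      using bessel[OF I(1) orth_order_p_subgroup] cT I(2) by fastforce
    have no_cyc: "\<not> (van p T (int p) 0 \<and> van p T 1 v)" for v
      using bessel[OF _ orth_cyclic_p2] cT by fastforce
    have no_trans: "\<not> ((\<forall>v. van p T 1 v) \<and> van p T (int p * u) 1)" for u
      using bessel[OF I(1) orth_transversal] cT I(2) by fastforce
    \<comment> \<open>If \<open>T\<close> vanishes at \<open>(p, 0)\<close>, it vanishes at no
      \<open>(1, v)\<close> and misses some \<open>(p u, 1)\<close>, so \<open>A\<close> has the
      transversal family. Otherwise \<open>A\<close> vanishes at \<open>(p, 0)\<close>, and either
      at all \<open>(p u, 1)\<close> or at some \<open>(1, v)\<close>.\<close>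
    show ?thesis
    proof (cases "van p T (int p) 0")
      case True
      then obtain u where "van p A (int p * u) 1" using no_sub van_pu1 by blast
      moreover have "van p A 1 v" for v using True no_cyc van_1v by blast
      ultimately have "orth p A ({..<p} \<times> {..<p}) (\<lambda>i. int (fst i) + int p * (u * int (snd i)))
          (\<lambda>i. int (snd i))"
        by (intro orth_transversal)
      from spectral[OF I(1) this] show ?thesis using I(2) 3 by simp
    next
      case False
      then have Ap: "van p A (int p) 0" using van_p0 by blast
      show ?thesis
      proof (cases "\<forall>u. van p A (int p * u) 1")
        case True
        then have "orth p A ({..<p} \<times> {..<p}) (\<lambda>i. int p * int (fst i)) (\<lambda>i. int (snd i))"
          by (intro orth_order_p_subgroup[OF Ap]) blast
        from spectral[OF I(1) this] show ?thesis using I(2) 3 by simp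
      next
        case False
        then obtain v where "van p A 1 v" using van_pu1 no_trans van_1v by blast
        from spectral[OF _ orth_cyclic_p2[OF Ap this]] show ?thesis using 3 by simp
      qed
    qed
  next
    case 4
    then have "card T = 1" using card p1 by simp
    then obtain t where "T = {t}" using card_1_singletonE by blast
    \<comment> \<open>A single term of modulus 1 is nonzero, so every nonzero frequency is left to
      \<open>A\<close>.\<close>
    then have "\<not> van p T x y" for x y
      by (simp add: van_def ee_def)
    then have "orth p A (grp p) (\<lambda>b. int (fst b)) (\<lambda>b. int (snd b))"
      using van by (intro orth_all) blast
    from spectral[OF finite_grp this] show ?thesis using 4 by (simp add: card_grp)
  qed
qed

section \<open>Spectral sets are tiles\<close>

text \<open>Phrased through differences because complete orthogonality constrains exactly the
  differences of distinct elements of \<open>A\<close>.\<close>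

lemma tile_of_disjoint_differences:
  fixes \<tau> \<sigma> :: "'i \<Rightarrow> int"
  assumes A: "A \<subseteq> grp p" "A \<noteq> {}" and I: "finite I" "card A * card I = p ^ 3"
    and inj: "\<And>i i'. \<lbrakk>i \<in> I; i' \<in> I; int p ^ 2 dvd \<tau> i - \<tau> i'; int p dvd \<sigma> i - \<sigma> i'\<rbrakk> \<Longrightarrow> i = i'"
    and disj: "\<And>a a' i i'. \<lbrakk>a \<in> A; a' \<in> A; a \<noteq> a'; i \<in> I; i' \<in> I;
      int p ^ 2 dvd (int (fst a) - int (fst a')) + (\<tau> i - \<tau> i');
      int p dvd (int (snd a) - int (snd a')) + (\<sigma> i - \<sigma> i')\<rbrakk> \<Longrightarrow> False"
  shows "is_tile p A"
proof (rule tile_of_family[OF A(1) I])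
  fix a a' i i'
  assume ai: "a \<in> A" "a' \<in> A" "i \<in> I" "i' \<in> I"
    and c: "[int (fst a) + \<tau> i = int (fst a') + \<tau> i'] (mod int p ^ 2)"
      "[int (snd a) + \<sigma> i = int (snd a') + \<sigma> i'] (mod int p)"
  have d: "int p ^ 2 dvd (int (fst a) - int (fst a')) + (\<tau> i - \<tau> i')"
    "int p dvd (int (snd a) - int (snd a')) + (\<sigma> i - \<sigma> i')"
    using c by (simp_all add: cong_iff_dvd_diff algebra_simps)
  have "a = a'" using disj[OF ai(1,2) _ ai(3,4) d] by blast
  then show "a = a' \<and> i = i'" using inj[OF ai(3,4)] d by simp
qed

section \<open>Complements dictated by complete orthogonal families\<close>

context
  fixes A :: "(nat \<times> nat) set"
  assumes A: "A \<subseteq> grp p" "A \<noteq> {}"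
begin

lemma finA: "finite A"
  using A finite_grp finite_subset by blast

lemma tile_of_card_eq_1: "card A = 1 \<Longrightarrow> is_tile p A"
proof (rule tile_of_disjoint_differences[OF A finite_grp[of p], of "\<lambda>b. int (fst b)" "\<lambda>b. int (snd b)"])
  assume 1: "card A = 1"
  then show "card A * card (grp p) = p ^ 3" by (simp add: card_grp)
  show "i = i'" if "i \<in> grp p" "i' \<in> grp p" "int p ^ 2 dvd int (fst i) - int (fst i')"
    "int p dvd int (snd i) - int (snd i')" for i i'
    using grp_eqI that by (simp add: cong_iff_dvd_diff)
  show False if "a \<in> A" "a' \<in> A" "a \<noteq> a'" for a a'
    using 1 that card_1_singletonE by (metis singletonD)
qed

lemma tile_grp: "A = grp p \<Longrightarrow> is_tile p A"
proof (rule tile_of_disjoint_differences[OF A, of "{()}" "\<lambda>_. 0" "\<lambda>_. 0"])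
  assume "A = grp p"
  then show "card A * card {()} = p ^ 3" by (simp add: card_grp)
  fix a a' :: "nat \<times> nat"
  assume "a \<in> A" "a' \<in> A" "a \<noteq> a'"
    and "int p ^ 2 dvd (int (fst a) - int (fst a')) + (0 - 0)"
      "int p dvd (int (snd a) - int (snd a')) + (0 - 0)"
  then show False using A grp_eqI[of a a'] by (auto simp: cong_iff_dvd_diff)
qed auto

text \<open>Completeness says that values of \<open>x + p v y\<close> at distinct points of
  \<open>A\<close> differ by a multiple of \<open>p\<close> but not of \<open>p^2\<close>. On the
  complement this form takes the values \<open>i < p\<close>, whose differences are never nonzero
  multiples of \<open>p\<close>.\<close>

lemma tile_line_1v:
  assumes card: "card A \<le> p" and van: "van p A 1 v"
  shows "is_tile p A"
proof -
  note orth = orth_line[OF van]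
  have cA: "card A = p" using orth_card_le[OF finA A(2) _ orth] card by simp
  have sep: "int p dvd \<alpha> + int p * (v * \<beta>) \<and> \<not> int p ^ 2 dvd \<alpha> + int p * (v * \<beta>)"
    if "a \<in> A" "a' \<in> A" "a \<noteq> a'" "\<alpha> = int (fst a) - int (fst a')" "\<beta> = int (snd a) - int (snd a')"
    for a a' \<alpha> \<beta>
  proof -
    have "(\<Sum>j<p. ee p (int j * (\<alpha> + int p * (v * \<beta>)))) = 0"
      unfolding that(4,5) using orth_complete[OF finA A(2) _ orth _ that(1,2,3)] cA
      by (simp add: algebra_simps)
    then show ?thesis unfolding sum_ee_p_eq_0_iff .
  qed
  show ?thesis
  proof (rule tile_of_disjoint_differences[OF A, of "{..<p} \<times> {..<p}"
        "\<lambda>i. int (fst i) - int p * (v * int (snd i))" "\<lambda>i. int (snd i)"])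
    show "card A * card ({..<p} \<times> {..<p}) = p ^ 3"
      using cA by (simp add: card_cartesian_product power3_eq_cube)
    fix i i' :: "nat \<times> nat"
    assume i: "i \<in> {..<p} \<times> {..<p}" "i' \<in> {..<p} \<times> {..<p}"
    define \<delta> \<epsilon> where "\<delta> = int (fst i) - int (fst i')" and "\<epsilon> = int (snd i) - int (snd i')"
    have \<tau>: "(int (fst i) - int p * (v * int (snd i))) - (int (fst i') - int p * (v * int (snd i'))) =
        \<delta> - int p * (v * \<epsilon>)" by (simp add: \<delta>_def \<epsilon>_def algebra_simps)
    have \<delta>0: "\<delta> = 0" if "int p dvd \<delta>"
      using nat_eq_of_dvd_diff[of "fst i" p "fst i'"] i that by (auto simp: \<delta>_def)
    {
      assume "int p ^ 2 dvd (int (fst i) - int p * (v * int (snd i))) - (int (fst i') - int p * (v * int (snd i')))"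
        and \<epsilon>: "int p dvd int (snd i) - int (snd i')"
      then have "int p dvd \<delta> - int p * (v * \<epsilon>)" unfolding \<tau> by (intro p_dvd_of_p2_dvd)
      then have "int p dvd \<delta>" by (simp add: dvd_diff_left_iff)
      then have "fst i = fst i'" using \<delta>0 by (simp add: \<delta>_def)
      moreover have "snd i = snd i'" using nat_eq_of_dvd_diff[OF _ _ \<epsilon>] i by auto
      ultimately show "i = i'" by (simp add: prod_eq_iff)
    }
    fix a a' assume a: "a \<in> A" "a' \<in> A" "a \<noteq> a'"
    define \<alpha> \<beta> where "\<alpha> = int (fst a) - int (fst a')" and "\<beta> = int (snd a) - int (snd a')"
    assume "int p ^ 2 dvd (int (fst a) - int (fst a')) +
        ((int (fst i) - int p * (v * int (snd i))) - (int (fst i') - int p * (v * int (snd i'))))"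
      and "int p dvd (int (snd a) - int (snd a')) + (int (snd i) - int (snd i'))"
    then have 1: "int p ^ 2 dvd \<alpha> + (\<delta> - int p * (v * \<epsilon>))" and "int p dvd \<beta> + \<epsilon>"
      unfolding \<tau> \<alpha>_def \<beta>_def \<epsilon>_def by auto
    then have "int p ^ 2 dvd int p * (v * (\<beta> + \<epsilon>))" unfolding p2_dvd_p_mult_iff by simp
    from dvd_add[OF 1 this] have 2: "int p ^ 2 dvd (\<alpha> + int p * (v * \<beta>)) + \<delta>"
      by (simp add: algebra_simps)
    note s = sep[OF a \<alpha>_def \<beta>_def]
    then have "int p dvd \<delta>" using p_dvd_of_p2_dvd[OF 2] by (simp add: dvd_add_right_iff)
    then show False using \<delta>0 2 s by simp
  qed auto
qed

text \<open>Completeness makes the first coordinates of \<open>A\<close> distinct modulo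
  \<open>p\<close>; the complement consists of all elements whose first coordinate is divisible by
  \<open>p\<close>.\<close>

lemma tile_line_p0:
  assumes card: "card A \<le> p" and van: "van p A (int p) 0"
  shows "is_tile p A"
proof -
  note orth = orth_line[OF van]
  have cA: "card A = p" using orth_card_le[OF finA A(2) _ orth] card by simp
  have sep: "\<not> int p dvd int (fst a) - int (fst a')" if "a \<in> A" "a' \<in> A" "a \<noteq> a'" for a a'
  proof -
    have "(\<Sum>j<p. ee p (int j * (int p * (int (fst a) - int (fst a'))))) = 0"
      using orth_complete[OF finA A(2) _ orth _ that] cA by (simp add: algebra_simps)
    then show ?thesis unfolding sum_ee_p_eq_0_iff p2_dvd_p_mult_iff by blast
  qed
  show ?thesis
  proof (rule tile_of_disjoint_differences[OF A, of "{..<p} \<times> {..<p}"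
        "\<lambda>i. int p * int (fst i)" "\<lambda>i. int (snd i)"])
    show "card A * card ({..<p} \<times> {..<p}) = p ^ 3"
      using cA by (simp add: card_cartesian_product power3_eq_cube)
    fix i i' :: "nat \<times> nat"
    assume i: "i \<in> {..<p} \<times> {..<p}" "i' \<in> {..<p} \<times> {..<p}"
    {
      assume "int p ^ 2 dvd int p * int (fst i) - int p * int (fst i')"
        and \<epsilon>: "int p dvd int (snd i) - int (snd i')"
      then have "int p dvd int (fst i) - int (fst i')"
        by (simp add: p2_dvd_p_mult_iff flip: right_diff_distrib)
      then show "i = i'"
        using nat_eq_of_dvd_diff[OF _ _ \<epsilon>] nat_eq_of_dvd_diff[of "fst i" p "fst i'"] i
        by (auto simp: prod_eq_iff)
    }
    fix a a' assume a: "a \<in> A" "a' \<in> A" "a \<noteq> a'"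
    assume "int p ^ 2 dvd (int (fst a) - int (fst a')) + (int p * int (fst i) - int p * int (fst i'))"
    then have "int p dvd (int (fst a) - int (fst a')) + int p * (int (fst i) - int (fst i'))"
      by (intro p_dvd_of_p2_dvd) (simp add: right_diff_distrib)
    then show False using sep[OF a] by (simp add: dvd_add_left_iff)
  qed auto
qed

text \<open>Completeness makes \<open>u x + y\<close> injective modulo \<open>p\<close> on
  \<open>A\<close>; the complement is the kernel of this map, generated by
  \<open>(1, -u)\<close>.\<close>

lemma tile_line_pu1:
  assumes card: "card A \<le> p" and van: "van p A (int p * u) 1"
  shows "is_tile p A"
proof -
  note orth = orth_line[OF van]
  have cA: "card A = p" using orth_card_le[OF finA A(2) _ orth] card by simp
  have sep: "\<not> int p dvd u * (int (fst a) - int (fst a')) + (int (snd a) - int (snd a'))"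
    if "a \<in> A" "a' \<in> A" "a \<noteq> a'" for a a'
  proof -
    have "(\<Sum>j<p. ee p (int j * (int p * (u * (int (fst a) - int (fst a')) + (int (snd a) - int (snd a')))))) = 0"
      using orth_complete[OF finA A(2) _ orth _ that] cA by (simp add: algebra_simps)
    then show ?thesis unfolding sum_ee_p_eq_0_iff p2_dvd_p_mult_iff by blast
  qed
  show ?thesis
  proof (rule tile_of_disjoint_differences[OF A, of "{..<p\<^sup>2}" int "\<lambda>i. - (u * int i)"])
    show "card A * card {..<p\<^sup>2} = p ^ 3"
      using cA by (simp add: power2_eq_square power3_eq_cube)
    show "i = i'" if "i \<in> {..<p\<^sup>2}" "i' \<in> {..<p\<^sup>2}" "int p ^ 2 dvd int i - int i'" for i i'
      using that nat_eq_of_dvd_diff[of i "p\<^sup>2" i'] by simp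
    fix i i' a a' assume a: "a \<in> A" "a' \<in> A" "a \<noteq> a'"
    assume "int p ^ 2 dvd (int (fst a) - int (fst a')) + (int i - int i')"
      and 2: "int p dvd (int (snd a) - int (snd a')) + (- (u * int i) - - (u * int i'))"
    then have "int p dvd u * ((int (fst a) - int (fst a')) + (int i - int i'))"
      by (intro dvd_mult p_dvd_of_p2_dvd)
    from dvd_add[OF this 2] show False using sep[OF a] by (simp add: algebra_simps)
  qed auto
qed

text \<open>The dual sum factors, so for distinct points either \<open>u x + y\<close> differs
  modulo \<open>p\<close>, or the first coordinates differ by exactly one factor \<open>p\<close>.
  The elements \<open>(i, -u i)\<close> with \<open>i < p\<close> avoid both: \<open>u x + y\<close>
  is 0 on them and their first coordinates are distinct modulo \<open>p\<close>.\<close>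

lemma tile_transversal:
  assumes card: "card A \<le> p ^ 2" and van: "\<And>v. van p A 1 v" "van p A (int p * u) 1"
  shows "is_tile p A"
proof -
  note orth = orth_transversal[OF van]
  have I: "card ({..<p} \<times> {..<p}) = p ^ 2" by (simp add: card_cartesian_product power2_eq_square)
  have cA: "card A = p ^ 2" using orth_card_le[OF finA A(2) _ orth] card I by simp
  have sep: "(int p dvd \<alpha> \<and> \<not> int p ^ 2 dvd \<alpha>) \<or> \<not> int p dvd u * \<alpha> + \<beta>"
    if "a \<in> A" "a' \<in> A" "a \<noteq> a'" "\<alpha> = int (fst a) - int (fst a')" "\<beta> = int (snd a) - int (snd a')"
    for a a' \<alpha> \<beta>
  proof -
    have "(\<Sum>i\<in>{..<p} \<times> {..<p}. ee p (int (fst i) * \<alpha> + int (snd i) * (int p * (u * \<alpha> + \<beta>)))) = 0"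
      unfolding that(4,5) using orth_complete[OF finA A(2) _ orth _ that(1,2,3)] cA I
      by (simp add: algebra_simps)
    then show ?thesis
      unfolding sum_ee_prod mult_eq_0_iff sum_ee_p_eq_0_iff p2_dvd_p_mult_iff by blast
  qed
  show ?thesis
  proof (rule tile_of_disjoint_differences[OF A, of "{..<p}" int "\<lambda>i. - (u * int i)"])
    show "card A * card {..<p} = p ^ 3"
      using cA by (simp add: power2_eq_square power3_eq_cube)
    show "i = i'" if "i \<in> {..<p}" "i' \<in> {..<p}" "int p ^ 2 dvd int i - int i'" for i i'
      using that nat_eq_of_dvd_diff[of i p i'] p_dvd_of_p2_dvd by simp
    fix i i' a a' assume a: "a \<in> A" "a' \<in> A" "a \<noteq> a'" and i: "i \<in> {..<p}" "i' \<in> {..<p}"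
    define \<alpha> \<beta> where "\<alpha> = int (fst a) - int (fst a')" and "\<beta> = int (snd a) - int (snd a')"
    assume "int p ^ 2 dvd (int (fst a) - int (fst a')) + (int i - int i')"
      and "int p dvd (int (snd a) - int (snd a')) + (- (u * int i) - - (u * int i'))"
    then have 1: "int p ^ 2 dvd \<alpha> + (int i - int i')"
      and 2: "int p dvd \<beta> + (- (u * int i) - - (u * int i'))" by (simp_all add: \<alpha>_def \<beta>_def)
    have "int p dvd u * (\<alpha> + (int i - int i'))" using 1 by (intro dvd_mult p_dvd_of_p2_dvd)
    from dvd_add[OF this 2] have "int p dvd u * \<alpha> + \<beta>" by (simp add: algebra_simps)
    then have \<alpha>: "int p dvd \<alpha>" "\<not> int p ^ 2 dvd \<alpha>" using sep[OF a \<alpha>_def \<beta>_def] by blast+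
    then have "int p dvd int i - int i'" using p_dvd_of_p2_dvd[OF 1] by (simp add: dvd_add_right_iff)
    then have "i = i'" using i nat_eq_of_dvd_diff by blast
    then show False using 1 \<alpha> by simp
  qed auto
qed

text \<open>Completeness makes \<open>x + p v y\<close> injective modulo \<open>p^2\<close> on
  \<open>A\<close>; the complement is the kernel of this map, generated by
  \<open>(-p v, 1)\<close>.\<close>

lemma tile_cyclic_p2:
  assumes card: "card A \<le> p ^ 2" and van: "van p A (int p) 0" "van p A 1 v"
  shows "is_tile p A"
proof -
  note orth = orth_cyclic_p2[OF van]
  have cA: "card A = p ^ 2" using orth_card_le[OF finA A(2) _ orth] card by simp
  have sep: "\<not> int p ^ 2 dvd (int (fst a) - int (fst a')) + int p * (v * (int (snd a) - int (snd a')))"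
    if "a \<in> A" "a' \<in> A" "a \<noteq> a'" for a a'
  proof -
    have "(\<Sum>i<p\<^sup>2. ee p (int i * ((int (fst a) - int (fst a')) + int p * (v * (int (snd a) - int (snd a')))))) = 0"
      using orth_complete[OF finA A(2) _ orth _ that] cA by (simp add: algebra_simps)
    then show ?thesis unfolding sum_ee_p2_eq_0_iff .
  qed
  show ?thesis
  proof (rule tile_of_disjoint_differences[OF A, of "{..<p}" "\<lambda>i. - (int p * (v * int i))" int])
    show "card A * card {..<p} = p ^ 3"
      using cA by (simp add: power2_eq_square power3_eq_cube)
    show "i = i'" if "i \<in> {..<p}" "i' \<in> {..<p}" "int p dvd int i - int i'" for i i'
      using that nat_eq_of_dvd_diff[of i p i'] by simp
    fix i i' a a' assume a: "a \<in> A" "a' \<in> A" "a \<noteq> a'"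
    assume 1: "int p ^ 2 dvd (int (fst a) - int (fst a')) + (- (int p * (v * int i)) - - (int p * (v * int i')))"
      and "int p dvd (int (snd a) - int (snd a')) + (int i - int i')"
    then have "int p ^ 2 dvd int p * (v * ((int (snd a) - int (snd a')) + (int i - int i')))"
      unfolding p2_dvd_p_mult_iff by (intro dvd_mult)
    from dvd_add[OF 1 this] show False using sep[OF a] by (simp add: algebra_simps)
  qed auto
qed

text \<open>Completeness makes \<open>A\<close> injective under reduction of both coordinates modulo
  \<open>p\<close>; the complement is the kernel of that reduction.\<close>

lemma tile_order_p_subgroup:
  assumes card: "card A \<le> p ^ 2" and van: "van p A (int p) 0" "\<And>u. van p A (int p * u) 1"
  shows "is_tile p A"
proof -
  note orth = orth_order_p_subgroup[OF van]
  have I: "card ({..<p} \<times> {..<p}) = p ^ 2" by (simp add: card_cartesian_product power2_eq_square)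
  have cA: "card A = p ^ 2" using orth_card_le[OF finA A(2) _ orth] card I by simp
  have sep: "\<not> (int p dvd int (fst a) - int (fst a') \<and> int p dvd int (snd a) - int (snd a'))"
    if "a \<in> A" "a' \<in> A" "a \<noteq> a'" for a a'
  proof -
    have "(\<Sum>i\<in>{..<p} \<times> {..<p}. ee p (int (fst i) * (int p * (int (fst a) - int (fst a'))) +
        int (snd i) * (int p * (int (snd a) - int (snd a'))))) = 0"
      using orth_complete[OF finA A(2) _ orth _ that] cA I by (simp add: algebra_simps)
    then show ?thesis
      unfolding sum_ee_prod mult_eq_0_iff sum_ee_p_eq_0_iff p2_dvd_p_mult_iff by blast
  qed
  show ?thesis
  proof (rule tile_of_disjoint_differences[OF A, of "{..<p}" "\<lambda>i. int p * int i" "\<lambda>_. 0"])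
    show "card A * card {..<p} = p ^ 3"
      using cA by (simp add: power2_eq_square power3_eq_cube)
    show "i = i'" if "i \<in> {..<p}" "i' \<in> {..<p}" "int p ^ 2 dvd int p * int i - int p * int i'" for i i'
      using that nat_eq_of_dvd_diff[of i p i'] by (simp add: p2_dvd_p_mult_iff flip: right_diff_distrib)
    fix i i' :: nat and a a' assume a: "a \<in> A" "a' \<in> A" "a \<noteq> a'"
    assume "int p ^ 2 dvd (int (fst a) - int (fst a')) + (int p * int i - int p * int i')"
      and 2: "int p dvd (int (snd a) - int (snd a')) + (0 - 0)"
    then have "int p dvd (int (fst a) - int (fst a')) + int p * (int i - int i')"
      by (intro p_dvd_of_p2_dvd) (simp add: right_diff_distrib)
    then have "int p dvd int (fst a) - int (fst a')" by (simp add: dvd_add_left_iff)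
    then show False using sep[OF a] 2 by simp
  qed auto
qed

end

text \<open>Only the range of \<open>card A\<close> is used at first: collisions in \<open>B\<close>
  under well-chosen maps give vanishing frequencies, and the resulting orthogonal family fixes
  \<open>card A\<close> as the upper end of its range.\<close>

lemma spectral_imp_tile:
  assumes sp: "spectral_set p A"
  shows "is_tile p A"
proof -
  have A: "A \<subseteq> grp p" "A \<noteq> {}" using sp unfolding spectral_set_def by blast+
  have fin: "finite A" using A finite_grp finite_subset by blast
  have p1: "p > 1" using p_gt_1 .
  obtain B where B: "B \<subseteq> grp p" "card B = card A"
    and orth: "orth p A B (\<lambda>b. int (fst b)) (\<lambda>b. int (snd b))"
    using spectral_imp_orth[OF sp] .
  have diff: "van p A (int (fst b) - int (fst b')) (int (snd b) - int (snd b'))"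
    "\<not> (int p ^ 2 dvd int (fst b) - int (fst b') \<and> int p dvd int (snd b) - int (snd b'))"
    if "b \<in> B" "b' \<in> B" "b \<noteq> b'" for b b'
    using that orth grp_eqI[of b b'] B(1) by (auto simp: orth_def cong_iff_dvd_diff)
  have van_p0: "van p A (int p) 0" if h: "van p A d e" "int p dvd d" "int p dvd e" "\<not> int p ^ 2 dvd d" for d e
  proof -
    obtain t where t: "d = int p * t" using h(2) by blast
    then have "\<not> int p dvd t" using h(4) p1 by (simp add: power2_eq_square)
    then show ?thesis using van_p0_iff[OF _ h(3)] h(1) t by blast
  qed
  have van_1v: "van p A 1 v" if "van p A d e" "\<not> int p dvd d" "int p dvd e - v * d" for d e v
    using van_unit_iff[OF that(2), of v e] that
    by (simp add: cong_iff_dvd_diff dvd_diff_commute mult.commute)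
  have van_pu1: "van p A (int p * u) 1" if "van p A d e" "\<not> int p dvd e" "int p ^ 2 dvd d - int p * (u * e)" for d e u
  proof -
    have "van p A (int p * (u * e)) e"
      using van_cong[of d "int p * (u * e)" e e] that by (simp add: cong_iff_dvd_diff)
    then show ?thesis using van_pu1_iff[OF that(2), of u "u * e"] by (simp add: mult.commute)
  qed
  have ex_pu1: "\<exists>u. van p A (int p * u) 1" if h: "van p A d e" "int p dvd d" "\<not> int p dvd e" for d e
  proof -
    obtain t where t: "d = int p * t" using h(2) by blast
    obtain u where "[e * u = t] (mod int p)" using solve_mod_p[OF h(3)] .
    then show ?thesis using van_pu1_iff[OF h(3)] h(1) t by blast
  qed
  have "card A > 0" using A fin by (simp add: card_gt_0_iff)
  then consider "card A = 1" | "1 < card A" "card A \<le> p" | "p < card A" "card A \<le> p ^ 2" | "p ^ 2 < card A"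
    by linarith
  then show ?thesis
  proof cases
    case 1
    then show ?thesis using tile_of_card_eq_1[OF A] by blast
  next
    case 2
    have "\<not> B \<subseteq> {b}" for b
      using 2 B(2) card_mono[of "{b}" B] by auto
    then obtain b b' where b: "b \<in> B" "b' \<in> B" "b \<noteq> b'" by blast
    define d e where "d = int (fst b) - int (fst b')" and "e = int (snd b) - int (snd b')"
    have de: "van p A d e" "\<not> (int p ^ 2 dvd d \<and> int p dvd e)"
      using diff[OF b] by (auto simp: d_def e_def)
    show ?thesis
    proof (cases "int p dvd d")
      case False
      then obtain v where "[d * v = e] (mod int p)" using solve_mod_p by blast
      then have "van p A 1 v" using van_unit_iff[OF False] de by blast
      then show ?thesis using tile_line_1v[OF A] 2 by blast
    next
      case True
      then show ?thesis
        using van_p0[OF de(1)] ex_pu1[OF de(1)] de(2) tile_line_p0[OF A 2(2)] tile_line_pu1[OF A 2(2)]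
        by blast
    qed
  next
    case 3
    \<comment> \<open>Two elements of \<open>B\<close> agree under \<open>y - v x\<close> modulo
      \<open>p\<close>. If \<open>p\<close> divided the first coordinate \<open>d\<close> of their
      difference, it would divide \<open>e\<close> too, and \<open>(p, 0)\<close> would
      vanish.\<close>
    have dir: "van p A 1 v" if np: "\<not> van p A (int p) 0" for v
    proof -
      have "\<exists>b\<in>B. \<exists>b'\<in>B. b \<noteq> b' \<and>
          (int (snd b) - v * int (fst b)) mod int p = (int (snd b') - v * int (fst b')) mod int p"
        by (rule collision[of "{0..<int p}"]) (use 3 B(2) p1 in auto)
      then obtain b b' where b: "b \<in> B" "b' \<in> B" "b \<noteq> b'"
        and eq: "(int (snd b) - v * int (fst b)) mod int p = (int (snd b') - v * int (fst b')) mod int p"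
        by blast
      define d e where "d = int (fst b) - int (fst b')" and "e = int (snd b) - int (snd b')"
      have de: "van p A d e" "\<not> (int p ^ 2 dvd d \<and> int p dvd e)"
        using diff[OF b] by (auto simp: d_def e_def)
      have dvd: "int p dvd e - v * d"
        using eq by (simp add: mod_eq_dvd_iff d_def e_def algebra_simps)
      have "\<not> int p dvd d"
      proof
        assume d: "int p dvd d"
        then have "int p dvd e" using dvd by (metis dvd_diff_left_iff dvd_mult)
        then show False using van_p0[OF de(1) d] de(2) np by blast
      qed
      then show ?thesis using van_1v[OF de(1)] dvd by blast
    qed
    show ?thesis
    proof (cases "van p A (int p) 0")
      case False
      have "\<exists>b\<in>B. \<exists>b'\<in>B. b \<noteq> b' \<and>
          int (fst b) mod int p = int (fst b') mod int p"
        by (rule collision[of "{0..<int p}"]) (use 3 B(2) p1 in auto)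
      then obtain b b' where b: "b \<in> B" "b' \<in> B" "b \<noteq> b'" and eq: "int (fst b) mod int p = int (fst b') mod int p"
        by blast
      define d e where "d = int (fst b) - int (fst b')" and "e = int (snd b) - int (snd b')"
      have de: "van p A d e" "\<not> (int p ^ 2 dvd d \<and> int p dvd e)"
        using diff[OF b] by (auto simp: d_def e_def)
      have d: "int p dvd d" using eq by (simp add: mod_eq_dvd_iff d_def)
      then have "\<not> int p dvd e" using van_p0[OF de(1)] de(2) False by blast
      then obtain u where "van p A (int p * u) 1" using ex_pu1[OF de(1) d] by blast
      then show ?thesis using tile_transversal[OF A] dir[OF False] 3 by blast
    next
      case True
      show ?thesis
      proof (cases "\<exists>v. van p A 1 v")
        case 1: True
        then show ?thesis using tile_cyclic_p2[OF A] True 3 by blast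
      next
        case 2: False
        \<comment> \<open>With no vanishing \<open>(1, v)\<close>, all first coordinates in
          \<open>B\<close> agree modulo \<open>p\<close>, so the quotients \<open>f\<close>
          determine their differences. A collision of \<open>f b - u y\<close> modulo
          \<open>p\<close> yields a unit multiple of \<open>(p u, 1)\<close>.\<close>
        have "van p A (int p * u) 1" for u
        proof -
          define f where "f b = int (fst b) div int p" for b :: "nat \<times> nat"
          have "\<exists>b\<in>B. \<exists>b'\<in>B. b \<noteq> b' \<and>
              (f b - u * int (snd b)) mod int p = (f b' - u * int (snd b')) mod int p"
            by (rule collision[of "{0..<int p}"]) (use 3 B(2) p1 in auto)
          then obtain b b' where b: "b \<in> B" "b' \<in> B" "b \<noteq> b'"
            and eq: "(f b - u * int (snd b)) mod int p = (f b' - u * int (snd b')) mod int p"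
            by blast
          define d e where "d = int (fst b) - int (fst b')" and "e = int (snd b) - int (snd b')"
          have de: "van p A d e" "\<not> (int p ^ 2 dvd d \<and> int p dvd e)"
            using diff[OF b] by (auto simp: d_def e_def)
          have "int p dvd d"
          proof (rule ccontr)
            assume "\<not> int p dvd d"
            then show False using van_unit_iff solve_mod_p de(1) 2 by metis
          qed
          then have "int (fst b) mod int p = int (fst b') mod int p" by (simp add: d_def mod_eq_dvd_iff)
          then have d: "d = int p * (f b - f b')"
            unfolding d_def f_def right_diff_distrib by (metis add_diff_cancel_right mult_div_mod_eq)
          have "int p dvd (f b - f b') - u * e"
            using eq by (simp add: mod_eq_dvd_iff e_def algebra_simps)
          then have d2: "int p ^ 2 dvd d - int p * (u * e)"
            unfolding d by (simp add: power2_eq_square mult_dvd_mono flip: right_diff_distrib)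
          have "\<not> int p dvd e"
          proof
            assume e: "int p dvd e"
            then have "int p ^ 2 dvd int p * (u * e)" by (simp add: power2_eq_square)
            then have "int p ^ 2 dvd d" using d2 by (simp add: dvd_diff_left_iff)
            then show False using de(2) e by blast
          qed
          then show ?thesis using van_pu1[OF de(1) _ d2] by blast
        qed
        then show ?thesis using tile_order_p_subgroup[OF A] True 3 by blast
      qed
    qed
  next
    case 4
    \<comment> \<open>Each of the three maps below has at most \<open>p^2\<close> values, so it has
      a collision on \<open>B\<close>. Here the colliding elements differ by a unit multiple of
      \<open>(p, 0)\<close>.\<close>
    have v1: "van p A (int p) 0"
    proof -
      have "\<exists>b\<in>B. \<exists>b'\<in>B. b \<noteq> b' \<and>
          (int (fst b) mod int p, snd b) = (int (fst b') mod int p, snd b')"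
        by (rule collision[of "{0..<int p} \<times> {0..<p}"])
          (use 4 B p1 in \<open>auto simp: grp_def card_cartesian_product power2_eq_square subset_iff\<close>)
      then obtain b b' where b: "b \<in> B" "b' \<in> B" "b \<noteq> b'"
        and eq: "int (fst b) mod int p = int (fst b') mod int p" "snd b = snd b'"
        by auto
      then show ?thesis using van_p0[OF diff(1)[OF b]] diff(2)[OF b] by (simp add: mod_eq_dvd_iff)
    qed
    have v2: "van p A (int p * u) 1" for u
    proof -
      have "\<exists>b\<in>B. \<exists>b'\<in>B. b \<noteq> b' \<and>
          (int (fst b) - int p * (u * int (snd b))) mod int p ^ 2 =
          (int (fst b') - int p * (u * int (snd b'))) mod int p ^ 2"
        by (rule collision[of "{0..<int p ^ 2}"])
          (use 4 B p1 in \<open>auto simp: nat_power_eq\<close>)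
      then obtain b b' where b: "b \<in> B" "b' \<in> B" "b \<noteq> b'"
        and eq: "(int (fst b) - int p * (u * int (snd b))) mod int p ^ 2 =
          (int (fst b') - int p * (u * int (snd b'))) mod int p ^ 2"
        by blast
      define d e where "d = int (fst b) - int (fst b')" and "e = int (snd b) - int (snd b')"
      have de: "van p A d e" "\<not> (int p ^ 2 dvd d \<and> int p dvd e)"
        using diff[OF b] by (auto simp: d_def e_def)
      have d2: "int p ^ 2 dvd d - int p * (u * e)"
        using eq by (simp add: mod_eq_dvd_iff d_def e_def algebra_simps)
      have "\<not> int p dvd e"
      proof
        assume e: "int p dvd e"
        then have "int p ^ 2 dvd int p * (u * e)" by (simp add: power2_eq_square)
        then have "int p ^ 2 dvd d" using d2 by (simp add: dvd_diff_left_iff)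
        then show False using de(2) e by blast
      qed
      then show ?thesis using van_pu1[OF de(1) _ d2] by blast
    qed
    have v3: "van p A 1 v" for v
    proof -
      \<comment> \<open>The quotient excludes a difference \<open>d\<close> divisible by
        \<open>p\<close>: equal quotients and equal remainders would give \<open>d = 0\<close>, and
        then \<open>p\<close> would divide \<open>e\<close> as well.\<close>
      define f where "f b = ((int (snd b) - v * int (fst b)) mod int p, fst b div p)" for b :: "nat \<times> nat"
      have fB: "f ` B \<subseteq> {0..<int p} \<times> {0..<p}"
        using B(1) p1 by (auto simp: f_def grp_def power2_eq_square less_mult_imp_div_less)
      have "\<exists>b\<in>B. \<exists>b'\<in>B. b \<noteq> b' \<and> f b = f b'"
        by (rule collision[of "{0..<int p} \<times> {0..<p}"])
          (use fB 4 B in \<open>auto simp: card_cartesian_product power2_eq_square\<close>)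
      then obtain b b' where b: "b \<in> B" "b' \<in> B" "b \<noteq> b'" and eq: "f b = f b'"
        by blast
      define d e where "d = int (fst b) - int (fst b')" and "e = int (snd b) - int (snd b')"
      have de: "van p A d e" "\<not> (int p ^ 2 dvd d \<and> int p dvd e)"
        using diff[OF b] by (auto simp: d_def e_def)
      have dvd: "int p dvd e - v * d"
        using eq by (simp add: f_def mod_eq_dvd_iff d_def e_def algebra_simps)
      have "\<not> int p dvd d"
      proof
        assume d: "int p dvd d"
        then have "int (fst b) mod int p = int (fst b') mod int p" by (simp add: d_def mod_eq_dvd_iff)
        then have "fst b mod p = fst b' mod p" by (metis of_nat_eq_iff zmod_int)
        moreover have "fst b div p = fst b' div p" using eq by (simp add: f_def)
        ultimately have "fst b = fst b'" by (metis mult_div_mod_eq)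
        then have "d = 0" by (simp add: d_def)
        then show False using de(2) dvd by simp
      qed
      then show ?thesis using van_1v[OF de(1)] dvd by blast
    qed
    \<comment> \<open>All characters are now orthogonal on \<open>A\<close>, so the bound on
      orthogonal families leaves only the whole group.\<close>
    have "orth p A (grp p) (\<lambda>b. int (fst b)) (\<lambda>b. int (snd b))"
      by (rule orth_all) (rule van_all[OF v1 v2 v3])
    then have "card (grp p) \<le> card A" using orth_card_le[OF fin A(2) finite_grp] by blast
    then have "A = grp p" using A finite_grp card_seteq by blast
    then show ?thesis using tile_grp[OF A] by blast
  qed
qed

end

theorem theorem1p2:
  fixes p :: nat and A :: "(nat \<times> nat) set"
  assumes "prime p" and "A \<subseteq> grp p"
  shows "spectral_set p A \<longleftrightarrow> is_tile p A"
  using spectral_imp_tile[OF assms(1)] tile_imp_spectral[OF assms(1)] by blast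

end
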